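(* Let $\mathcal{Q}$ be a small quantaloid, let $\phi:\mathbb{A}\nrightarrow\mathbb{B}$ and $\psi:\mathbb{A}'\nrightarrow\mathbb{B}'$ be $\mathcal{Q}$-distributors, and let $(F,G):\phi\to\psi$ be an infomorphism. Then $F:(\mathbb{A},\phi^{\downarrow}\circ\phi_{\uparrow})\to(\mathbb{A}',\psi^{\downarrow}\circ\psi_{\uparrow})$ is a continuous $\mathcal{Q}$-functor between $\mathcal{Q}$-closure spaces.
   Context: A small quantaloid $\mathcal{Q}$ is a category with a set $\mathcal{Q}_0$ of objects, each hom-set $\mathcal{Q}(A,B)$ a complete lattice, and composition $\circ$ preserving arbitrary joins in each variable. For $f\in\mathcal{Q}(A,B)$ and $g\in\mathcal{Q}(A,X)$, $g\swarrow f\in\mathcal{Q}(B,X)$ is the largest $h$ with $h\circ f\le g$; for $f\in\mathcal{Q}(A,B)$ and $g\in\mathcal{Q}(X,B)$, $f\searrow g\in\mathcal{Q}(X,A)$ is the largest $h$ with $f\circ h\le g$. A $\mathcal{Q}$-category $\mathbb{A}$ is a set $\mathbb{A}_0$ with a type map $t:\mathbb{A}_0\to\mathcal{Q}_0$ and hom-arrows $\mathbb{A}(x,y)\in\mathcal{Q}(tx,ty)$ such that $1_{tx}\le\mathbb{A}(x,x)$ and $\mathbb{A}(y,z)\circ\mathbb{A}(x,y)\le\mathbb{A}(x,z)$. A $\mathcal{Q}$-functor $F:\mathbb{A}\to\mathbb{B}$ is a type-preserving map $\mathbb{A}_0\to\mathbb{B}_0$ with $\mathbb{A}(x,x')\le\mathbb{B}(Fx,Fx')$.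 Underlying preorder: $x\le y$ iff $tx=ty$ and $1_{tx}\le\mathbb{A}(x,y)$; $x\cong y$ iff $x\le y$ and $y\le x$; $\mathcal{Q}$-functors are preordered pointwise (and $\cong$ is pointwise). A $\mathcal{Q}$-distributor $\phi:\mathbb{A}\nrightarrow\mathbb{B}$ is a family $\phi(x,y)\in\mathcal{Q}(tx,ty)$ ($x\in\mathbb{A}_0,y\in\mathbb{B}_0$) with $\mathbb{B}(y',y)\circ\phi(x,y')\le\phi(x,y)$ and $\phi(x',y)\circ\mathbb{A}(x,x')\le\phi(x,y)$; distributors are ordered pointwise. For $\phi:\mathbb{A}\nrightarrow\mathbb{B}$, $\psi:\mathbb{B}\nrightarrow\mathbb{C}$, $\eta:\mathbb{A}\nrightarrow\mathbb{C}$: $(\psi\circ\phi)(x,z)=\bigvee_y\psi(y,z)\circ\phi(x,y)$; $\eta\swarrow\phi:\mathbb{B}\nrightarrow\mathbb{C}$ is $(\eta\swarrow\phi)(y,z)=\bigwedge_x\eta(x,z)\swarrow\phi(x,y)$; $\psi\searrow\eta:\mathbb{A}\nrightarrow\mathbb{B}$ is $(\psi\searrow\eta)(x,y)=\bigwedge_z\psi(y,z)\searrow\eta(x,z)$. The graph and cograph of $F:\mathbb{A}\to\mathbb{B}$ are $F_{\natural}:\mathbb{A}\nrightarrow\mathbb{B}$, $F_{\natural}(x,y)=\mathbb{B}(Fx,y)$ and $F^{\natural}:\mathbb{B}\nrightarrow\mathbb{A}$, $F^{\natural}(y,x)=\mathbb{B}(y,Fx)$. For $X\in\mathcal{Q}_0$,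 $*_X$ is the $\mathcal{Q}$-category with one object of type $X$ and hom-arrow $1_X$. $\mathcal{P}\mathbb{A}$ has as objects of type $X$ the distributors $\mu:\mathbb{A}\nrightarrow *_X$, with $\mathcal{P}\mathbb{A}(\mu,\lambda)=\lambda\swarrow\mu$ (underlying order: pointwise). $\mathcal{P}^{\dagger}\mathbb{A}$ has as objects of type $X$ the distributors $\mu:*_X\nrightarrow\mathbb{A}$, with $\mathcal{P}^{\dagger}\mathbb{A}(\mu,\lambda)=\lambda\searrow\mu$. For a $\mathcal{Q}$-functor $F:\mathbb{A}\to\mathbb{B}$, $F^{\rightarrow}:\mathcal{P}\mathbb{A}\to\mathcal{P}\mathbb{B}$ is $F^{\rightarrow}(\mu)=\mu\circ F^{\natural}$. For a distributor $\phi:\mathbb{A}\nrightarrow\mathbb{B}$: $\phi_{\uparrow}:\mathcal{P}\mathbb{A}\to\mathcal{P}^{\dagger}\mathbb{B}$, $\phi_{\uparrow}(\mu)=\phi\swarrow\mu$, and $\phi^{\downarrow}:\mathcal{P}^{\dagger}\mathbb{B}\to\mathcal{P}\mathbb{A}$, $\phi^{\downarrow}(\lambda)=\lambda\searrow\phi$; $\phi^{\downarrow}\circ\phi_{\uparrow}$ is a $\mathcal{Q}$-closure operator on $\mathcal{P}\mathbb{A}$. An infomorphism $(F,G):(\phi:\mathbb{A}\nrightarrow\mathbb{B})\to(\psi:\mathbb{A}'\nrightarrow\mathbb{B}')$ is a pair of $\mathcal{Q}$-functors $F:\mathbb{A}\to\mathbb{A}'$, $G:\mathbb{B}'\to\mathbb{B}$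 with $G^{\natural}\circ\phi=\psi\circ F_{\natural}$, equivalently $\phi(x,Gy')=\psi(Fx,y')$ for all $x\in\mathbb{A}_0,y'\in\mathbb{B}'_0$. A $\mathcal{Q}$-closure operator on a $\mathcal{Q}$-category $\mathbb{C}$ is a $\mathcal{Q}$-functor $C:\mathbb{C}\to\mathbb{C}$ with $1_{\mathbb{C}}\le C$ and $C^2\cong C$. A $\mathcal{Q}$-closure space is a pair $(\mathbb{A},C)$ with $\mathbb{A}$ a $\mathcal{Q}$-category and $C$ a $\mathcal{Q}$-closure operator on $\mathcal{P}\mathbb{A}$. A continuous $\mathcal{Q}$-functor $F:(\mathbb{A},C)\to(\mathbb{B},D)$ is a $\mathcal{Q}$-functor $F:\mathbb{A}\to\mathbb{B}$ with $F^{\rightarrow}\circ C\le D\circ F^{\rightarrow}$. *)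

theory Defs
  imports "HOL-Algebra.Complete_Lattice"
begin

section \<open>Small quantaloids\<close>

text \<open>
  Hom-sets are ordered sets in the sense of HOL-Algebra. They form a family indexed by
  pairs of objects and need not be disjoint, so composition is indexed by objects as well:
  \<open>Comp Q A B C g f\<close> is \<open>g \<circ> f\<close> for \<open>f \<in> Q(A, B)\<close> and \<open>g \<in> Q(B, C)\<close>.
\<close>

record ('o, 'm) quantaloid_data =
  Ob :: "'o set"
  Hom :: "'o \<Rightarrow> 'o \<Rightarrow> 'm gorder"
  Comp :: "'o \<Rightarrow> 'o \<Rightarrow> 'o \<Rightarrow> 'm \<Rightarrow> 'm \<Rightarrow> 'm"
  Idn :: "'o \<Rightarrow> 'm"

locale quantaloid =
  fixes Q :: "('o, 'm) quantaloid_data"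
  assumes complete_lattice_Hom:
      "\<lbrakk>A \<in> Ob Q; B \<in> Ob Q\<rbrakk> \<Longrightarrow> complete_lattice (Hom Q A B)"
    and Idn_closed: "A \<in> Ob Q \<Longrightarrow> Idn Q A \<in> carrier (Hom Q A A)"
    and Comp_closed:
      "\<lbrakk>A \<in> Ob Q; B \<in> Ob Q; C \<in> Ob Q; f \<in> carrier (Hom Q A B); g \<in> carrier (Hom Q B C)\<rbrakk>
        \<Longrightarrow> Comp Q A B C g f \<in> carrier (Hom Q A C)"
    and Comp_assoc:
      "\<lbrakk>A \<in> Ob Q; B \<in> Ob Q; C \<in> Ob Q; D \<in> Ob Q;
        f \<in> carrier (Hom Q A B); g \<in> carrier (Hom Q B C); h \<in> carrier (Hom Q C D)\<rbrakk>
        \<Longrightarrow> Comp Q A B D (Comp Q B C D h g) f = Comp Q A C D h (Comp Q A B C g f)"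
    and Comp_Idn_right:
      "\<lbrakk>A \<in> Ob Q; B \<in> Ob Q; f \<in> carrier (Hom Q A B)\<rbrakk> \<Longrightarrow> Comp Q A A B f (Idn Q A) = f"
    and Comp_Idn_left:
      "\<lbrakk>A \<in> Ob Q; B \<in> Ob Q; f \<in> carrier (Hom Q A B)\<rbrakk> \<Longrightarrow> Comp Q A B B (Idn Q B) f = f"
    and Comp_Sup_right:
      "\<lbrakk>A \<in> Ob Q; B \<in> Ob Q; C \<in> Ob Q; S \<subseteq> carrier (Hom Q A B); g \<in> carrier (Hom Q B C)\<rbrakk>
        \<Longrightarrow> Comp Q A B C g (\<Squnion>\<^bsub>Hom Q A B\<^esub> S) = \<Squnion>\<^bsub>Hom Q A C\<^esub> ((\<lambda>f. Comp Q A B C g f) ` S)"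
    and Comp_Sup_left:
      "\<lbrakk>A \<in> Ob Q; B \<in> Ob Q; C \<in> Ob Q; f \<in> carrier (Hom Q A B); S \<subseteq> carrier (Hom Q B C)\<rbrakk>
        \<Longrightarrow> Comp Q A B C (\<Squnion>\<^bsub>Hom Q B C\<^esub> S) f = \<Squnion>\<^bsub>Hom Q A C\<^esub> ((\<lambda>g. Comp Q A B C g f) ` S)"

text \<open>
  \<open>limp Q A B X g f\<close> is \<open>g \<swarrow> f \<in> Q(B, X)\<close> for \<open>f \<in> Q(A, B)\<close> and \<open>g \<in> Q(A, X)\<close>;
  \<open>rimp Q X A B f g\<close> is \<open>f \<searrow> g \<in> Q(X, A)\<close> for \<open>f \<in> Q(A, B)\<close> and \<open>g \<in> Q(X, B)\<close>.
\<close>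

definition limp :: "('o, 'm) quantaloid_data \<Rightarrow> 'o \<Rightarrow> 'o \<Rightarrow> 'o \<Rightarrow> 'm \<Rightarrow> 'm \<Rightarrow> 'm" where
  "limp Q A B X g f =
     (THE h. greatest (Hom Q B X) h
        {h \<in> carrier (Hom Q B X). Comp Q A B X h f \<sqsubseteq>\<^bsub>Hom Q A X\<^esub> g})"

definition rimp :: "('o, 'm) quantaloid_data \<Rightarrow> 'o \<Rightarrow> 'o \<Rightarrow> 'o \<Rightarrow> 'm \<Rightarrow> 'm \<Rightarrow> 'm" where
  "rimp Q X A B f g =
     (THE h. greatest (Hom Q X A) h
        {h \<in> carrier (Hom Q X A). Comp Q X A B f h \<sqsubseteq>\<^bsub>Hom Q X B\<^esub> g})"


section \<open>Categories and functors enriched in a quantaloid\<close>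

record ('o, 'm, 'a) qcat_data =
  obs :: "'a set"
  ty :: "'a \<Rightarrow> 'o"
  arr :: "'a \<Rightarrow> 'a \<Rightarrow> 'm"

definition qcategory :: "('o, 'm) quantaloid_data \<Rightarrow> ('o, 'm, 'a) qcat_data \<Rightarrow> bool" where
  "qcategory Q \<A> \<longleftrightarrow>
     ty \<A> \<in> obs \<A> \<rightarrow> Ob Q \<and>
     (\<forall>x\<in>obs \<A>. \<forall>y\<in>obs \<A>. arr \<A> x y \<in> carrier (Hom Q (ty \<A> x) (ty \<A> y))) \<and>
     (\<forall>x\<in>obs \<A>. Idn Q (ty \<A> x) \<sqsubseteq>\<^bsub>Hom Q (ty \<A> x) (ty \<A> x)\<^esub> arr \<A> x x) \<and>
     (\<forall>x\<in>obs \<A>. \<forall>y\<in>obs \<A>. \<forall>z\<in>obs \<A>.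
        Comp Q (ty \<A> x) (ty \<A> y) (ty \<A> z) (arr \<A> y z) (arr \<A> x y)
          \<sqsubseteq>\<^bsub>Hom Q (ty \<A> x) (ty \<A> z)\<^esub> arr \<A> x z)"

definition qfunctor ::
  "('o, 'm) quantaloid_data \<Rightarrow> ('o, 'm, 'a) qcat_data \<Rightarrow> ('o, 'm, 'b) qcat_data
    \<Rightarrow> ('a \<Rightarrow> 'b) \<Rightarrow> bool" where
  "qfunctor Q \<A> \<B> F \<longleftrightarrow>
     qcategory Q \<A> \<and> qcategory Q \<B> \<and>
     F \<in> obs \<A> \<rightarrow> obs \<B> \<and>
     (\<forall>x\<in>obs \<A>. ty \<B> (F x) = ty \<A> x) \<and>
     (\<forall>x\<in>obs \<A>. \<forall>x'\<in>obs \<A>.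
        arr \<A> x x' \<sqsubseteq>\<^bsub>Hom Q (ty \<A> x) (ty \<A> x')\<^esub> arr \<B> (F x) (F x'))"

definition qle ::
  "('o, 'm) quantaloid_data \<Rightarrow> ('o, 'm, 'a) qcat_data \<Rightarrow> 'a \<Rightarrow> 'a \<Rightarrow> bool" where
  "qle Q \<A> x y \<longleftrightarrow>
     ty \<A> x = ty \<A> y \<and> Idn Q (ty \<A> x) \<sqsubseteq>\<^bsub>Hom Q (ty \<A> x) (ty \<A> y)\<^esub> arr \<A> x y"

definition qiso ::
  "('o, 'm) quantaloid_data \<Rightarrow> ('o, 'm, 'a) qcat_data \<Rightarrow> 'a \<Rightarrow> 'a \<Rightarrow> bool" where
  "qiso Q \<A> x y \<longleftrightarrow> qle Q \<A> x y \<and> qle Q \<A> y x"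

definition qfunctor_le ::
  "('o, 'm) quantaloid_data \<Rightarrow> ('o, 'm, 'a) qcat_data \<Rightarrow> ('o, 'm, 'b) qcat_data
    \<Rightarrow> ('a \<Rightarrow> 'b) \<Rightarrow> ('a \<Rightarrow> 'b) \<Rightarrow> bool" where
  "qfunctor_le Q \<A> \<B> F G \<longleftrightarrow> (\<forall>x\<in>obs \<A>. qle Q \<B> (F x) (G x))"

definition qfunctor_iso ::
  "('o, 'm) quantaloid_data \<Rightarrow> ('o, 'm, 'a) qcat_data \<Rightarrow> ('o, 'm, 'b) qcat_data
    \<Rightarrow> ('a \<Rightarrow> 'b) \<Rightarrow> ('a \<Rightarrow> 'b) \<Rightarrow> bool" where
  "qfunctor_iso Q \<A> \<B> F G \<longleftrightarrow> (\<forall>x\<in>obs \<A>. qiso Q \<B> (F x) (G x))"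


section \<open>Distributors\<close>

text \<open>
  A distributor is a family indexed by pairs of objects. It is represented by a function
  with value \<open>undefined\<close> at all other arguments, so that equality of distributors is
  equality in HOL and the sets of presheaves below have the right elements.
\<close>

definition qdistributor ::
  "('o, 'm) quantaloid_data \<Rightarrow> ('o, 'm, 'a) qcat_data \<Rightarrow> ('o, 'm, 'b) qcat_data
    \<Rightarrow> ('a \<Rightarrow> 'b \<Rightarrow> 'm) \<Rightarrow> bool" where
  "qdistributor Q \<A> \<B> \<phi> \<longleftrightarrow>
     qcategory Q \<A> \<and> qcategory Q \<B> \<and>
     (\<forall>x\<in>obs \<A>. \<forall>y\<in>obs \<B>. \<phi> x y \<in> carrier (Hom Q (ty \<A> x) (ty \<B> y))) \<and>
     (\<forall>x y. \<not> (x \<in> obs \<A> \<and> y \<in> obs \<B>) \<longrightarrow> \<phi> x y = undefined) \<and>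
     (\<forall>x\<in>obs \<A>. \<forall>y'\<in>obs \<B>. \<forall>y\<in>obs \<B>.
        Comp Q (ty \<A> x) (ty \<B> y') (ty \<B> y) (arr \<B> y' y) (\<phi> x y')
          \<sqsubseteq>\<^bsub>Hom Q (ty \<A> x) (ty \<B> y)\<^esub> \<phi> x y) \<and>
     (\<forall>x\<in>obs \<A>. \<forall>x'\<in>obs \<A>. \<forall>y\<in>obs \<B>.
        Comp Q (ty \<A> x) (ty \<A> x') (ty \<B> y) (\<phi> x' y) (arr \<A> x x')
          \<sqsubseteq>\<^bsub>Hom Q (ty \<A> x) (ty \<B> y)\<^esub> \<phi> x y)"

abbreviation family ::
  "('o, 'm, 'a) qcat_data \<Rightarrow> ('o, 'm, 'b) qcat_data \<Rightarrow> ('a \<Rightarrow> 'b \<Rightarrow> 'm) \<Rightarrow> 'a \<Rightarrow> 'b \<Rightarrow> 'm" where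
  "family \<A> \<B> \<phi> \<equiv> (\<lambda>x y. if x \<in> obs \<A> \<and> y \<in> obs \<B> then \<phi> x y else undefined)"

text \<open>\<open>dcomp Q \<A> \<B> \<C> \<psi> \<phi>\<close> is \<open>\<psi> \<circ> \<phi>\<close> for \<open>\<phi>\<close> from \<open>\<A>\<close> to \<open>\<B>\<close> and \<open>\<psi>\<close> from \<open>\<B>\<close> to \<open>\<C>\<close>.\<close>

definition dcomp ::
  "('o, 'm) quantaloid_data \<Rightarrow> ('o, 'm, 'a) qcat_data \<Rightarrow> ('o, 'm, 'b) qcat_data
    \<Rightarrow> ('o, 'm, 'c) qcat_data \<Rightarrow> ('b \<Rightarrow> 'c \<Rightarrow> 'm) \<Rightarrow> ('a \<Rightarrow> 'b \<Rightarrow> 'm) \<Rightarrow> 'a \<Rightarrow> 'c \<Rightarrow> 'm" where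
  "dcomp Q \<A> \<B> \<C> \<psi> \<phi> = family \<A> \<C> (\<lambda>x z.
     \<Squnion>\<^bsub>Hom Q (ty \<A> x) (ty \<C> z)\<^esub>
       ((\<lambda>y. Comp Q (ty \<A> x) (ty \<B> y) (ty \<C> z) (\<psi> y z) (\<phi> x y)) ` obs \<B>))"

text \<open>\<open>dlimp Q \<A> \<B> \<C> \<eta> \<phi>\<close> is \<open>\<eta> \<swarrow> \<phi>\<close> from \<open>\<B>\<close> to \<open>\<C>\<close>, for \<open>\<phi>\<close> from \<open>\<A>\<close> to \<open>\<B>\<close> and \<open>\<eta>\<close> from \<open>\<A>\<close> to \<open>\<C>\<close>.\<close>

definition dlimp ::
  "('o, 'm) quantaloid_data \<Rightarrow> ('o, 'm, 'a) qcat_data \<Rightarrow> ('o, 'm, 'b) qcat_data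
    \<Rightarrow> ('o, 'm, 'c) qcat_data \<Rightarrow> ('a \<Rightarrow> 'c \<Rightarrow> 'm) \<Rightarrow> ('a \<Rightarrow> 'b \<Rightarrow> 'm) \<Rightarrow> 'b \<Rightarrow> 'c \<Rightarrow> 'm" where
  "dlimp Q \<A> \<B> \<C> \<eta> \<phi> = family \<B> \<C> (\<lambda>y z.
     \<Sqinter>\<^bsub>Hom Q (ty \<B> y) (ty \<C> z)\<^esub>
       ((\<lambda>x. limp Q (ty \<A> x) (ty \<B> y) (ty \<C> z) (\<eta> x z) (\<phi> x y)) ` obs \<A>))"

text \<open>\<open>drimp Q \<A> \<B> \<C> \<psi> \<eta>\<close> is \<open>\<psi> \<searrow> \<eta>\<close> from \<open>\<A>\<close> to \<open>\<B>\<close>, for \<open>\<psi>\<close> from \<open>\<B>\<close> to \<open>\<C>\<close> and \<open>\<eta>\<close> from \<open>\<A>\<close> to \<open>\<C>\<close>.\<close>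

definition drimp ::
  "('o, 'm) quantaloid_data \<Rightarrow> ('o, 'm, 'a) qcat_data \<Rightarrow> ('o, 'm, 'b) qcat_data
    \<Rightarrow> ('o, 'm, 'c) qcat_data \<Rightarrow> ('b \<Rightarrow> 'c \<Rightarrow> 'm) \<Rightarrow> ('a \<Rightarrow> 'c \<Rightarrow> 'm) \<Rightarrow> 'a \<Rightarrow> 'b \<Rightarrow> 'm" where
  "drimp Q \<A> \<B> \<C> \<psi> \<eta> = family \<A> \<B> (\<lambda>x y.
     \<Sqinter>\<^bsub>Hom Q (ty \<A> x) (ty \<B> y)\<^esub>
       ((\<lambda>z. rimp Q (ty \<A> x) (ty \<B> y) (ty \<C> z) (\<psi> y z) (\<eta> x z)) ` obs \<C>))"

text \<open>In both of the following, \<open>F\<close> is a functor from \<open>\<A>\<close> to \<open>\<B>\<close>.\<close>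

definition graph ::
  "('o, 'm, 'a) qcat_data \<Rightarrow> ('o, 'm, 'b) qcat_data \<Rightarrow> ('a \<Rightarrow> 'b) \<Rightarrow> 'a \<Rightarrow> 'b \<Rightarrow> 'm" where
  "graph \<A> \<B> F = family \<A> \<B> (\<lambda>x y. arr \<B> (F x) y)"

definition cograph ::
  "('o, 'm, 'a) qcat_data \<Rightarrow> ('o, 'm, 'b) qcat_data \<Rightarrow> ('a \<Rightarrow> 'b) \<Rightarrow> 'b \<Rightarrow> 'a \<Rightarrow> 'm" where
  "cograph \<A> \<B> F = family \<B> \<A> (\<lambda>y x. arr \<B> y (F x))"

definition infomorphism ::
  "('o, 'm) quantaloid_data
    \<Rightarrow> ('o, 'm, 'a) qcat_data \<Rightarrow> ('o, 'm, 'b) qcat_data \<Rightarrow> ('a \<Rightarrow> 'b \<Rightarrow> 'm)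
    \<Rightarrow> ('o, 'm, 'c) qcat_data \<Rightarrow> ('o, 'm, 'd) qcat_data \<Rightarrow> ('c \<Rightarrow> 'd \<Rightarrow> 'm)
    \<Rightarrow> ('a \<Rightarrow> 'c) \<Rightarrow> ('d \<Rightarrow> 'b) \<Rightarrow> bool" where
  "infomorphism Q \<A> \<B> \<phi> \<A>' \<B>' \<psi> F G \<longleftrightarrow>
     qdistributor Q \<A> \<B> \<phi> \<and> qdistributor Q \<A>' \<B>' \<psi> \<and>
     qfunctor Q \<A> \<A>' F \<and> qfunctor Q \<B>' \<B> G \<and>
     dcomp Q \<A> \<B> \<B>' (cograph \<B>' \<B> G) \<phi> = dcomp Q \<A> \<A>' \<B>' \<psi> (graph \<A> \<A>' F)"


section \<open>Presheaves\<close>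

definition star :: "('o, 'm) quantaloid_data \<Rightarrow> 'o \<Rightarrow> ('o, 'm, unit) qcat_data" where
  "star Q X = \<lparr>obs = {()}, ty = (\<lambda>_. X), arr = (\<lambda>_ _. Idn Q X)\<rparr>"

text \<open>
  A presheaf carries its type: the object \<open>(X, \<mu>)\<close> is a distributor \<open>\<mu>\<close> to (respectively
  from) \<open>star Q X\<close>. A distributor between two one-object categories is identified with its
  only component.
\<close>

definition presheaves ::
  "('o, 'm) quantaloid_data \<Rightarrow> ('o, 'm, 'a) qcat_data
    \<Rightarrow> ('o, 'm, 'o \<times> ('a \<Rightarrow> unit \<Rightarrow> 'm)) qcat_data" where
  "presheaves Q \<A> =
     \<lparr>obs = {(X, \<mu>). X \<in> Ob Q \<and> qdistributor Q \<A> (star Q X) \<mu>},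
      ty = fst,
      arr = (\<lambda>(X, \<mu>) (Y, \<nu>). dlimp Q \<A> (star Q X) (star Q Y) \<nu> \<mu> () ())\<rparr>"

definition copresheaves ::
  "('o, 'm) quantaloid_data \<Rightarrow> ('o, 'm, 'a) qcat_data
    \<Rightarrow> ('o, 'm, 'o \<times> (unit \<Rightarrow> 'a \<Rightarrow> 'm)) qcat_data" where
  "copresheaves Q \<A> =
     \<lparr>obs = {(X, \<mu>). X \<in> Ob Q \<and> qdistributor Q (star Q X) \<A> \<mu>},
      ty = fst,
      arr = (\<lambda>(X, \<mu>) (Y, \<nu>). drimp Q (star Q X) (star Q Y) \<A> \<nu> \<mu> () ())\<rparr>"

definition direct_image ::
  "('o, 'm) quantaloid_data \<Rightarrow> ('o, 'm, 'a) qcat_data \<Rightarrow> ('o, 'm, 'b) qcat_data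
    \<Rightarrow> ('a \<Rightarrow> 'b) \<Rightarrow> 'o \<times> ('a \<Rightarrow> unit \<Rightarrow> 'm) \<Rightarrow> 'o \<times> ('b \<Rightarrow> unit \<Rightarrow> 'm)" where
  "direct_image Q \<A> \<B> F = (\<lambda>(X, \<mu>). (X, dcomp Q \<B> \<A> (star Q X) \<mu> (cograph \<A> \<B> F)))"

definition isbell_up ::
  "('o, 'm) quantaloid_data \<Rightarrow> ('o, 'm, 'a) qcat_data \<Rightarrow> ('o, 'm, 'b) qcat_data
    \<Rightarrow> ('a \<Rightarrow> 'b \<Rightarrow> 'm) \<Rightarrow> 'o \<times> ('a \<Rightarrow> unit \<Rightarrow> 'm) \<Rightarrow> 'o \<times> (unit \<Rightarrow> 'b \<Rightarrow> 'm)" where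
  "isbell_up Q \<A> \<B> \<phi> = (\<lambda>(X, \<mu>). (X, dlimp Q \<A> (star Q X) \<B> \<phi> \<mu>))"

definition isbell_down ::
  "('o, 'm) quantaloid_data \<Rightarrow> ('o, 'm, 'a) qcat_data \<Rightarrow> ('o, 'm, 'b) qcat_data
    \<Rightarrow> ('a \<Rightarrow> 'b \<Rightarrow> 'm) \<Rightarrow> 'o \<times> (unit \<Rightarrow> 'b \<Rightarrow> 'm) \<Rightarrow> 'o \<times> ('a \<Rightarrow> unit \<Rightarrow> 'm)" where
  "isbell_down Q \<A> \<B> \<phi> = (\<lambda>(X, \<nu>). (X, drimp Q \<A> (star Q X) \<B> \<nu> \<phi>))"


section \<open>Closure spaces\<close>

definition qclosure_operator ::
  "('o, 'm) quantaloid_data \<Rightarrow> ('o, 'm, 'a) qcat_data \<Rightarrow> ('a \<Rightarrow> 'a) \<Rightarrow> bool" where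
  "qclosure_operator Q \<C> C \<longleftrightarrow>
     qfunctor Q \<C> \<C> C \<and> qfunctor_le Q \<C> \<C> id C \<and> qfunctor_iso Q \<C> \<C> (C \<circ> C) C"

definition qclosure_space ::
  "('o, 'm) quantaloid_data \<Rightarrow> ('o, 'm, 'a) qcat_data
    \<Rightarrow> ('o \<times> ('a \<Rightarrow> unit \<Rightarrow> 'm) \<Rightarrow> 'o \<times> ('a \<Rightarrow> unit \<Rightarrow> 'm)) \<Rightarrow> bool" where
  "qclosure_space Q \<A> C \<longleftrightarrow> qcategory Q \<A> \<and> qclosure_operator Q (presheaves Q \<A>) C"

definition continuous_qfunctor ::
  "('o, 'm) quantaloid_data
    \<Rightarrow> ('o, 'm, 'a) qcat_data \<Rightarrow> ('o \<times> ('a \<Rightarrow> unit \<Rightarrow> 'm) \<Rightarrow> 'o \<times> ('a \<Rightarrow> unit \<Rightarrow> 'm))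
    \<Rightarrow> ('o, 'm, 'b) qcat_data \<Rightarrow> ('o \<times> ('b \<Rightarrow> unit \<Rightarrow> 'm) \<Rightarrow> 'o \<times> ('b \<Rightarrow> unit \<Rightarrow> 'm))
    \<Rightarrow> ('a \<Rightarrow> 'b) \<Rightarrow> bool" where
  "continuous_qfunctor Q \<A> C \<B> D F \<longleftrightarrow>
     qclosure_space Q \<A> C \<and> qclosure_space Q \<B> D \<and> qfunctor Q \<A> \<B> F \<and>
     qfunctor_le Q (presheaves Q \<A>) (presheaves Q \<B>)
       (direct_image Q \<A> \<B> F \<circ> C) (D \<circ> direct_image Q \<A> \<B> F)"

end

theory Submission
  imports Defs
begin

text \<open>
  Everything rests on the universal properties of residuals. For a distributor \<open>\<phi>\<close> from \<open>\<A>\<close> to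
  \<open>\<B>\<close> and a presheaf \<open>\<mu>\<close> on \<open>\<A>\<close> write \<open>u = \<phi>\<^sub>\<up> \<mu>\<close> and \<open>c = \<phi>\<^sup>\<down> u\<close>. Then \<open>u y\<close> is the largest
  arrow with \<open>u y \<circ> \<mu> x \<le> \<phi> x y\<close> for all \<open>x\<close>, and \<open>c x\<close> is the largest arrow with
  \<open>u y \<circ> c x \<le> \<phi> x y\<close> for all \<open>y\<close> (\<open>below_up_iff\<close>, \<open>below_cl_iff\<close>). This is a Galois
  correspondence, and its composite is a closure operator for the usual reasons: \<open>\<mu> \<le> c\<close> because
  \<open>\<mu>\<close> satisfies the condition that defines \<open>c\<close>; passing to \<open>c\<close> does not shrink \<open>u\<close>, so a second
  closure adds nothing; and the enriched functoriality follows from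
  \<open>\<phi>\<^sub>\<up> \<nu> y \<circ> P(\<mu>, \<nu>) \<le> \<phi>\<^sub>\<up> \<mu> y\<close>, where \<open>P\<close> is the category of presheaves (\<open>up_antitone\<close>).

  For continuity, the Yoneda lemma turns the equation of distributors that defines an
  infomorphism into \<open>\<phi> x (G y) = \<psi> (F x) y\<close> (\<open>infomorphism_components\<close>). Let \<open>\<mu>'\<close> be the direct
  image of \<open>\<mu>\<close> and \<open>v = \<psi>\<^sub>\<up> \<mu>'\<close>. As \<open>\<mu> x \<le> \<mu>' (F x)\<close>,
  \<open>v y \<circ> \<mu> x \<le> v y \<circ> \<mu>' (F x) \<le> \<psi> (F x) y = \<phi> x (G y)\<close>,
  hence \<open>v y \<le> u (G y)\<close> (\<open>up_pushforward_below\<close>). Composing with \<open>c x\<close> gives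
  \<open>v y \<circ> c x \<le> u (G y) \<circ> c x \<le> \<phi> x (G y) = \<psi> (F x) y\<close>, and the action of \<open>\<A>'\<close> on \<open>\<psi>\<close> extends
  this to \<open>v y \<circ> (c x \<circ> \<A>'(x', F x)) \<le> \<psi> x' y\<close>. The arrows \<open>c x \<circ> \<A>'(x', F x)\<close> are those whose
  join is the direct image of \<open>c\<close> at \<open>x'\<close>, so that direct image lies below the closure of \<open>\<mu>'\<close>.
\<close>

section \<open>Typed inequalities\<close>

context quantaloid
begin

abbreviation hom :: "'o \<Rightarrow> 'o \<Rightarrow> 'm set" where
  "hom A B \<equiv> carrier (Hom Q A B)"

text \<open>
  The orders of the hom-sets are unconstrained outside their carriers. An inequality that records
  the membership of both sides is transitive and compatible with composition without any
  further side condition.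
\<close>

definition below :: "'m \<Rightarrow> 'o \<Rightarrow> 'o \<Rightarrow> 'm \<Rightarrow> bool" ("(_ \<preceq>\<langle>_,_\<rangle> _)" [51, 0, 0, 51] 50) where
  "f \<preceq>\<langle>A,B\<rangle> g \<longleftrightarrow> A \<in> Ob Q \<and> B \<in> Ob Q \<and> f \<in> hom A B \<and> g \<in> hom A B \<and> f \<sqsubseteq>\<^bsub>Hom Q A B\<^esub> g"

lemma below_refl: "A \<in> Ob Q \<Longrightarrow> B \<in> Ob Q \<Longrightarrow> f \<in> hom A B \<Longrightarrow> f \<preceq>\<langle>A,B\<rangle> f"
proof -
  assume *: "A \<in> Ob Q" "B \<in> Ob Q" "f \<in> hom A B"
  interpret complete_lattice "Hom Q A B" using * by (intro complete_lattice_Hom)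
  show ?thesis using * by (simp add: below_def)
qed

lemma below_trans [trans]:
  assumes "f \<preceq>\<langle>A,B\<rangle> g" "g \<preceq>\<langle>A,B\<rangle> h"
  shows "f \<preceq>\<langle>A,B\<rangle> h"
proof -
  interpret complete_lattice "Hom Q A B"
    using assms by (intro complete_lattice_Hom) (auto simp: below_def)
  show ?thesis using assms le_trans by (auto simp: below_def)
qed

lemma below_antisym:
  assumes "f \<preceq>\<langle>A,B\<rangle> g" "g \<preceq>\<langle>A,B\<rangle> f"
  shows "f = g"
proof -
  interpret complete_lattice "Hom Q A B"
    using assms by (intro complete_lattice_Hom) (auto simp: below_def)
  show ?thesis using assms le_antisym by (auto simp: below_def)
qed

lemma Sup_below_iff:
  assumes "A \<in> Ob Q" "B \<in> Ob Q" "S \<subseteq> hom A B" "g \<in> hom A B"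
  shows "\<Squnion>\<^bsub>Hom Q A B\<^esub> S \<preceq>\<langle>A,B\<rangle> g \<longleftrightarrow> (\<forall>f\<in>S. f \<preceq>\<langle>A,B\<rangle> g)"
proof -
  interpret complete_lattice "Hom Q A B" using assms by (intro complete_lattice_Hom)
  have closed: "\<Squnion>\<^bsub>Hom Q A B\<^esub> S \<in> hom A B" using assms by simp
  have "f \<preceq>\<langle>A,B\<rangle> \<Squnion>\<^bsub>Hom Q A B\<^esub> S" if "f \<in> S" for f
    using that assms closed weak.sup_upper[of S f] by (auto simp: below_def)
  moreover have "\<Squnion>\<^bsub>Hom Q A B\<^esub> S \<preceq>\<langle>A,B\<rangle> g" if "\<forall>f\<in>S. f \<preceq>\<langle>A,B\<rangle> g"
    using that assms closed weak.sup_least[of S g] by (auto simp: below_def)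
  ultimately show ?thesis by (meson below_trans)
qed

lemma below_Inf_iff:
  assumes "A \<in> Ob Q" "B \<in> Ob Q" "S \<subseteq> hom A B" "g \<in> hom A B"
  shows "g \<preceq>\<langle>A,B\<rangle> \<Sqinter>\<^bsub>Hom Q A B\<^esub> S \<longleftrightarrow> (\<forall>f\<in>S. g \<preceq>\<langle>A,B\<rangle> f)"
proof -
  interpret complete_lattice "Hom Q A B" using assms by (intro complete_lattice_Hom)
  have closed: "\<Sqinter>\<^bsub>Hom Q A B\<^esub> S \<in> hom A B" using assms by simp
  have "\<Sqinter>\<^bsub>Hom Q A B\<^esub> S \<preceq>\<langle>A,B\<rangle> f" if "f \<in> S" for f
    using that assms closed weak.inf_lower[of S f] by (auto simp: below_def)
  moreover have "g \<preceq>\<langle>A,B\<rangle> \<Sqinter>\<^bsub>Hom Q A B\<^esub> S" if "\<forall>f\<in>S. g \<preceq>\<langle>A,B\<rangle> f"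
    using that assms closed weak.inf_greatest[of S g] by (auto simp: below_def)
  ultimately show ?thesis by (meson below_trans)
qed


lemma Sup_closed:
  assumes "A \<in> Ob Q" "B \<in> Ob Q" "S \<subseteq> hom A B"
  shows "\<Squnion>\<^bsub>Hom Q A B\<^esub> S \<in> hom A B"
proof -
  interpret complete_lattice "Hom Q A B" using assms by (intro complete_lattice_Hom)
  show ?thesis using assms by simp
qed

lemma Inf_closed:
  assumes "A \<in> Ob Q" "B \<in> Ob Q" "S \<subseteq> hom A B"
  shows "\<Sqinter>\<^bsub>Hom Q A B\<^esub> S \<in> hom A B"
proof -
  interpret complete_lattice "Hom Q A B" using assms by (intro complete_lattice_Hom)
  show ?thesis using assms by simp
qed

text \<open>An inequality \<open>f \<le> f'\<close> says that \<open>f'\<close> is the join of \<open>{f, f'}\<close>, and composition preserves joins.\<close>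

lemma Sup_pair:
  assumes "f \<preceq>\<langle>A,B\<rangle> f'"
  shows "\<Squnion>\<^bsub>Hom Q A B\<^esub> {f, f'} = f'"
proof -
  have ty: "A \<in> Ob Q" "B \<in> Ob Q" "{f, f'} \<subseteq> hom A B" "f' \<in> hom A B"
    using assms by (auto simp: below_def)
  have "\<Squnion>\<^bsub>Hom Q A B\<^esub> {f, f'} \<preceq>\<langle>A,B\<rangle> f'"
    using ty assms by (subst Sup_below_iff) (auto intro: below_refl)
  moreover have "f' \<preceq>\<langle>A,B\<rangle> \<Squnion>\<^bsub>Hom Q A B\<^esub> {f, f'}"
    using Sup_below_iff[OF ty(1-3) Sup_closed[OF ty(1-3)]] below_refl[OF ty(1,2)]
      Sup_closed[OF ty(1-3)] by blast
  ultimately show ?thesis by (rule below_antisym)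
qed

lemma Comp_mono_right:
  assumes "f \<preceq>\<langle>A,B\<rangle> f'" "C \<in> Ob Q" "g \<in> hom B C"
  shows "Comp Q A B C g f \<preceq>\<langle>A,C\<rangle> Comp Q A B C g f'"
proof -
  have ty: "A \<in> Ob Q" "B \<in> Ob Q" "f \<in> hom A B" "f' \<in> hom A B"
    using assms(1) by (auto simp: below_def)
  let ?S = "(\<lambda>f. Comp Q A B C g f) ` {f, f'}"
  have S: "?S \<subseteq> hom A C" using ty assms by (auto intro: Comp_closed)
  have "Comp Q A B C g f' = \<Squnion>\<^bsub>Hom Q A C\<^esub> ?S"
    using Comp_Sup_right[of A B C "{f, f'}" g] Sup_pair[OF assms(1)] ty assms by simp
  then show ?thesis
    using Sup_below_iff[OF ty(1) assms(2) S Sup_closed[OF ty(1) assms(2) S]]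
      below_refl[OF ty(1) assms(2) Sup_closed[OF ty(1) assms(2) S]] by auto
qed

lemma Comp_mono_left:
  assumes "g \<preceq>\<langle>B,C\<rangle> g'" "A \<in> Ob Q" "f \<in> hom A B"
  shows "Comp Q A B C g f \<preceq>\<langle>A,C\<rangle> Comp Q A B C g' f"
proof -
  have ty: "B \<in> Ob Q" "C \<in> Ob Q" "g \<in> hom B C" "g' \<in> hom B C"
    using assms(1) by (auto simp: below_def)
  let ?S = "(\<lambda>g. Comp Q A B C g f) ` {g, g'}"
  have S: "?S \<subseteq> hom A C" using ty assms by (auto intro: Comp_closed)
  have "Comp Q A B C g' f = \<Squnion>\<^bsub>Hom Q A C\<^esub> ?S"
    using Comp_Sup_left[of A B C f "{g, g'}"] Sup_pair[OF assms(1)] ty assms by simp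
  then show ?thesis
    using Sup_below_iff[OF assms(2) ty(2) S Sup_closed[OF assms(2) ty(2) S]]
      below_refl[OF assms(2) ty(2) Sup_closed[OF assms(2) ty(2) S]] by auto
qed

section \<open>Residuation\<close>

lemma greatest_Sup:
  assumes "A \<in> Ob Q" "B \<in> Ob Q" "S \<subseteq> hom A B" "\<Squnion>\<^bsub>Hom Q A B\<^esub> S \<in> S"
  shows "(THE h. greatest (Hom Q A B) h S) = \<Squnion>\<^bsub>Hom Q A B\<^esub> S"
proof -
  interpret complete_lattice "Hom Q A B" using assms by (intro complete_lattice_Hom)
  have "greatest (Hom Q A B) (\<Squnion>\<^bsub>Hom Q A B\<^esub> S) S"
    using assms weak.sup_upper[of S] by (auto simp: greatest_def)
  then show ?thesis by (blast intro: greatest_unique)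
qed

text \<open>
  Composition with a fixed arrow preserves joins, so the join of all solutions \<open>h\<close> of
  \<open>h \<circ> f \<le> g\<close> is again a solution. Hence the largest solution exists.
\<close>

lemma limp_eq_Sup:
  assumes "A \<in> Ob Q" "B \<in> Ob Q" "X \<in> Ob Q" "f \<in> hom A B" "g \<in> hom A X"
  defines "S \<equiv> {h \<in> hom B X. Comp Q A B X h f \<sqsubseteq>\<^bsub>Hom Q A X\<^esub> g}"
  shows "limp Q A B X g f = \<Squnion>\<^bsub>Hom Q B X\<^esub> S" and "\<Squnion>\<^bsub>Hom Q B X\<^esub> S \<in> S"
proof -
  have S: "S \<subseteq> hom B X" by (auto simp: S_def)
  have img: "Comp Q A B X h f \<preceq>\<langle>A,X\<rangle> g" if "h \<in> S" for h
    using that assms by (simp add: below_def Comp_closed)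
  then have "(\<lambda>h. Comp Q A B X h f) ` S \<subseteq> hom A X" by (auto simp: below_def)
  then have "\<Squnion>\<^bsub>Hom Q A X\<^esub> ((\<lambda>h. Comp Q A B X h f) ` S) \<preceq>\<langle>A,X\<rangle> g"
    using assms(1,3,5) img by (simp add: Sup_below_iff)
  then have "Comp Q A B X (\<Squnion>\<^bsub>Hom Q B X\<^esub> S) f \<preceq>\<langle>A,X\<rangle> g"
    using assms(1-4) S by (simp add: Comp_Sup_left)
  then show mem: "\<Squnion>\<^bsub>Hom Q B X\<^esub> S \<in> S"
    using Sup_closed[of B X S] assms S by (auto simp: S_def below_def)
  show "limp Q A B X g f = \<Squnion>\<^bsub>Hom Q B X\<^esub> S"
    using greatest_Sup[of B X S] S mem assms(2,3) by (simp add: limp_def S_def)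
qed

lemma rimp_eq_Sup:
  assumes "X \<in> Ob Q" "A \<in> Ob Q" "B \<in> Ob Q" "f \<in> hom A B" "g \<in> hom X B"
  defines "S \<equiv> {h \<in> hom X A. Comp Q X A B f h \<sqsubseteq>\<^bsub>Hom Q X B\<^esub> g}"
  shows "rimp Q X A B f g = \<Squnion>\<^bsub>Hom Q X A\<^esub> S" and "\<Squnion>\<^bsub>Hom Q X A\<^esub> S \<in> S"
proof -
  have S: "S \<subseteq> hom X A" by (auto simp: S_def)
  have img: "Comp Q X A B f h \<preceq>\<langle>X,B\<rangle> g" if "h \<in> S" for h
    using that assms by (simp add: below_def Comp_closed)
  then have "(\<lambda>h. Comp Q X A B f h) ` S \<subseteq> hom X B" by (auto simp: below_def)
  then have "\<Squnion>\<^bsub>Hom Q X B\<^esub> ((\<lambda>h. Comp Q X A B f h) ` S) \<preceq>\<langle>X,B\<rangle> g"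
    using assms(1,3,5) img by (simp add: Sup_below_iff)
  then have "Comp Q X A B f (\<Squnion>\<^bsub>Hom Q X A\<^esub> S) \<preceq>\<langle>X,B\<rangle> g"
    using assms(1-4) S by (simp add: Comp_Sup_right)
  then show mem: "\<Squnion>\<^bsub>Hom Q X A\<^esub> S \<in> S"
    using Sup_closed[of X A S] assms S by (auto simp: S_def below_def)
  show "rimp Q X A B f g = \<Squnion>\<^bsub>Hom Q X A\<^esub> S"
    using greatest_Sup[of X A S] S mem assms(1,2) by (simp add: rimp_def S_def)
qed

lemma limp_closed:
  assumes "A \<in> Ob Q" "B \<in> Ob Q" "X \<in> Ob Q" "f \<in> hom A B" "g \<in> hom A X"
  shows "limp Q A B X g f \<in> hom B X"
  using limp_eq_Sup[OF assms] by auto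

lemma rimp_closed:
  assumes "X \<in> Ob Q" "A \<in> Ob Q" "B \<in> Ob Q" "f \<in> hom A B" "g \<in> hom X B"
  shows "rimp Q X A B f g \<in> hom X A"
  using rimp_eq_Sup[OF assms] by auto

lemma below_limp_iff:
  assumes "A \<in> Ob Q" "B \<in> Ob Q" "X \<in> Ob Q" "f \<in> hom A B" "g \<in> hom A X" "h \<in> hom B X"
  shows "h \<preceq>\<langle>B,X\<rangle> limp Q A B X g f \<longleftrightarrow> Comp Q A B X h f \<preceq>\<langle>A,X\<rangle> g"
proof
  let ?S = "{h \<in> hom B X. Comp Q A B X h f \<sqsubseteq>\<^bsub>Hom Q A X\<^esub> g}"
  note lub = limp_eq_Sup[OF assms(1-5)]
  have S: "?S \<subseteq> hom B X" by auto
  {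
    assume "h \<preceq>\<langle>B,X\<rangle> limp Q A B X g f"
    then have "Comp Q A B X h f \<preceq>\<langle>A,X\<rangle> Comp Q A B X (limp Q A B X g f) f"
      using assms by (intro Comp_mono_left)
    also have "\<dots> \<preceq>\<langle>A,X\<rangle> g"
      using lub assms by (auto simp: below_def Comp_closed)
    finally show "Comp Q A B X h f \<preceq>\<langle>A,X\<rangle> g" .
  next
    assume "Comp Q A B X h f \<preceq>\<langle>A,X\<rangle> g"
    then have "h \<in> ?S" using assms by (auto simp: below_def)
    then show "h \<preceq>\<langle>B,X\<rangle> limp Q A B X g f"
      using Sup_below_iff[OF assms(2,3) S Sup_closed[OF assms(2,3) S]]
        below_refl[OF assms(2,3) Sup_closed[OF assms(2,3) S]] lub(1) by auto
  }
qed

lemma below_rimp_iff: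
  assumes "X \<in> Ob Q" "A \<in> Ob Q" "B \<in> Ob Q" "f \<in> hom A B" "g \<in> hom X B" "h \<in> hom X A"
  shows "h \<preceq>\<langle>X,A\<rangle> rimp Q X A B f g \<longleftrightarrow> Comp Q X A B f h \<preceq>\<langle>X,B\<rangle> g"
proof
  let ?S = "{h \<in> hom X A. Comp Q X A B f h \<sqsubseteq>\<^bsub>Hom Q X B\<^esub> g}"
  note lub = rimp_eq_Sup[OF assms(1-5)]
  have S: "?S \<subseteq> hom X A" by auto
  {
    assume "h \<preceq>\<langle>X,A\<rangle> rimp Q X A B f g"
    then have "Comp Q X A B f h \<preceq>\<langle>X,B\<rangle> Comp Q X A B f (rimp Q X A B f g)"
      using assms by (intro Comp_mono_right)
    also have "\<dots> \<preceq>\<langle>X,B\<rangle> g"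
      using lub assms by (auto simp: below_def Comp_closed)
    finally show "Comp Q X A B f h \<preceq>\<langle>X,B\<rangle> g" .
  next
    assume "Comp Q X A B f h \<preceq>\<langle>X,B\<rangle> g"
    then have "h \<in> ?S" using assms by (auto simp: below_def)
    then show "h \<preceq>\<langle>X,A\<rangle> rimp Q X A B f g"
      using Sup_below_iff[OF assms(1,2) S Sup_closed[OF assms(1,2) S]]
        below_refl[OF assms(1,2) Sup_closed[OF assms(1,2) S]] lub(1) by auto
  }
qed


section \<open>Composition and residuation of distributors\<close>

text \<open>
  The defining inequalities of categories and distributors hold between arrows of the right type,
  so they can be restated with the typed order.
\<close>

lemma qcategory_iff:
  "qcategory Q \<A> \<longleftrightarrow>
     (\<forall>x\<in>obs \<A>. ty \<A> x \<in> Ob Q) \<and>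
     (\<forall>x\<in>obs \<A>. \<forall>y\<in>obs \<A>. arr \<A> x y \<in> hom (ty \<A> x) (ty \<A> y)) \<and>
     (\<forall>x\<in>obs \<A>. Idn Q (ty \<A> x) \<preceq>\<langle>ty \<A> x,ty \<A> x\<rangle> arr \<A> x x) \<and>
     (\<forall>x\<in>obs \<A>. \<forall>y\<in>obs \<A>. \<forall>z\<in>obs \<A>.
        Comp Q (ty \<A> x) (ty \<A> y) (ty \<A> z) (arr \<A> y z) (arr \<A> x y)
          \<preceq>\<langle>ty \<A> x,ty \<A> z\<rangle> arr \<A> x z)"
  unfolding qcategory_def below_def by (auto simp: Pi_iff Idn_closed Comp_closed)

lemma qdistributor_iff:
  "qdistributor Q \<A> \<B> \<phi> \<longleftrightarrow>
     qcategory Q \<A> \<and> qcategory Q \<B> \<and>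
     (\<forall>x\<in>obs \<A>. \<forall>y\<in>obs \<B>. \<phi> x y \<in> hom (ty \<A> x) (ty \<B> y)) \<and>
     (\<forall>x y. \<not> (x \<in> obs \<A> \<and> y \<in> obs \<B>) \<longrightarrow> \<phi> x y = undefined) \<and>
     (\<forall>x\<in>obs \<A>. \<forall>y'\<in>obs \<B>. \<forall>y\<in>obs \<B>.
        Comp Q (ty \<A> x) (ty \<B> y') (ty \<B> y) (arr \<B> y' y) (\<phi> x y')
          \<preceq>\<langle>ty \<A> x,ty \<B> y\<rangle> \<phi> x y) \<and>
     (\<forall>x\<in>obs \<A>. \<forall>x'\<in>obs \<A>. \<forall>y\<in>obs \<B>.
        Comp Q (ty \<A> x) (ty \<A> x') (ty \<B> y) (\<phi> x' y) (arr \<A> x x')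
          \<preceq>\<langle>ty \<A> x,ty \<B> y\<rangle> \<phi> x y)"
proof (cases "qcategory Q \<A> \<and> qcategory Q \<B>
    \<and> (\<forall>x\<in>obs \<A>. \<forall>y\<in>obs \<B>. \<phi> x y \<in> hom (ty \<A> x) (ty \<B> y))")
  case True
  then have "ty \<A> x \<in> Ob Q" "arr \<A> x x' \<in> hom (ty \<A> x) (ty \<A> x')"
    if "x \<in> obs \<A>" "x' \<in> obs \<A>" for x x'
    using that by (auto simp: qcategory_iff)
  moreover have "ty \<B> y \<in> Ob Q" "arr \<B> y y' \<in> hom (ty \<B> y) (ty \<B> y')"
    if "y \<in> obs \<B>" "y' \<in> obs \<B>" for y y'
    using True that by (auto simp: qcategory_iff)
  ultimately show ?thesis
    using True by (simp add: qdistributor_def below_def Comp_closed)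
next
  case False
  then show ?thesis by (auto simp: qdistributor_def)
qed

lemma qcategoryD:
  assumes "qcategory Q \<A>"
  shows ty_in_Ob: "x \<in> obs \<A> \<Longrightarrow> ty \<A> x \<in> Ob Q"
    and arr_in_hom: "x \<in> obs \<A> \<Longrightarrow> y \<in> obs \<A> \<Longrightarrow> arr \<A> x y \<in> hom (ty \<A> x) (ty \<A> y)"
    and Idn_below_arr: "x \<in> obs \<A> \<Longrightarrow> Idn Q (ty \<A> x) \<preceq>\<langle>ty \<A> x,ty \<A> x\<rangle> arr \<A> x x"
    and Comp_arr_below: "x \<in> obs \<A> \<Longrightarrow> y \<in> obs \<A> \<Longrightarrow> z \<in> obs \<A> \<Longrightarrow>
        Comp Q (ty \<A> x) (ty \<A> y) (ty \<A> z) (arr \<A> y z) (arr \<A> x y)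
          \<preceq>\<langle>ty \<A> x,ty \<A> z\<rangle> arr \<A> x z"
  using assms by (auto simp: qcategory_iff)

lemma qdistributorD:
  assumes "qdistributor Q \<A> \<B> \<phi>"
  shows qdistributor_dom: "qcategory Q \<A>"
    and qdistributor_cod: "qcategory Q \<B>"
    and qdistributor_in_hom: "x \<in> obs \<A> \<Longrightarrow> y \<in> obs \<B> \<Longrightarrow> \<phi> x y \<in> hom (ty \<A> x) (ty \<B> y)"
    and qdistributor_cod_action: "x \<in> obs \<A> \<Longrightarrow> y' \<in> obs \<B> \<Longrightarrow> y \<in> obs \<B> \<Longrightarrow>
        Comp Q (ty \<A> x) (ty \<B> y') (ty \<B> y) (arr \<B> y' y) (\<phi> x y')
          \<preceq>\<langle>ty \<A> x,ty \<B> y\<rangle> \<phi> x y"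
    and qdistributor_dom_action: "x \<in> obs \<A> \<Longrightarrow> x' \<in> obs \<A> \<Longrightarrow> y \<in> obs \<B> \<Longrightarrow>
        Comp Q (ty \<A> x) (ty \<A> x') (ty \<B> y) (\<phi> x' y) (arr \<A> x x')
          \<preceq>\<langle>ty \<A> x,ty \<B> y\<rangle> \<phi> x y"
  using assms by (auto simp: qdistributor_iff)

context
  fixes \<A> :: "('o, 'm, 'a) qcat_data" and \<B> :: "('o, 'm, 'b) qcat_data"
    and \<C> :: "('o, 'm, 'c) qcat_data" and \<phi> \<psi>
  assumes \<phi>: "qdistributor Q \<A> \<B> \<phi>" and \<psi>: "qdistributor Q \<B> \<C> \<psi>"
begin

lemma dcomp_below_iff:
  assumes "x \<in> obs \<A>" "z \<in> obs \<C>" "h \<in> hom (ty \<A> x) (ty \<C> z)"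
  shows "dcomp Q \<A> \<B> \<C> \<psi> \<phi> x z \<preceq>\<langle>ty \<A> x,ty \<C> z\<rangle> h \<longleftrightarrow>
    (\<forall>y\<in>obs \<B>. Comp Q (ty \<A> x) (ty \<B> y) (ty \<C> z) (\<psi> y z) (\<phi> x y) \<preceq>\<langle>ty \<A> x,ty \<C> z\<rangle> h)"
  using assms qdistributorD(1-3)[OF \<phi>] qdistributorD(1-3)[OF \<psi>]
  by (simp add: dcomp_def Sup_below_iff image_subset_iff ty_in_Ob Comp_closed)

lemma dcomp_in_hom:
  assumes "x \<in> obs \<A>" "z \<in> obs \<C>"
  shows "dcomp Q \<A> \<B> \<C> \<psi> \<phi> x z \<in> hom (ty \<A> x) (ty \<C> z)"
  using assms qdistributorD(1-3)[OF \<phi>] qdistributorD(1-3)[OF \<psi>]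
  by (simp add: dcomp_def Sup_closed image_subset_iff ty_in_Ob Comp_closed)

lemma Comp_below_dcomp:
  assumes "x \<in> obs \<A>" "y \<in> obs \<B>" "z \<in> obs \<C>"
  shows "Comp Q (ty \<A> x) (ty \<B> y) (ty \<C> z) (\<psi> y z) (\<phi> x y)
    \<preceq>\<langle>ty \<A> x,ty \<C> z\<rangle> dcomp Q \<A> \<B> \<C> \<psi> \<phi> x z"
  using dcomp_below_iff[of x z "dcomp Q \<A> \<B> \<C> \<psi> \<phi> x z"] assms
    below_refl[OF ty_in_Ob[OF qdistributorD(1)[OF \<phi>]] ty_in_Ob[OF qdistributorD(2)[OF \<psi>]] dcomp_in_hom]
    dcomp_in_hom by blast

lemma dcomp_qdistributor: "qdistributor Q \<A> \<C> (dcomp Q \<A> \<B> \<C> \<psi> \<phi>)"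
  unfolding qdistributor_iff
proof (intro conjI ballI allI impI)
  let ?d = "dcomp Q \<A> \<B> \<C> \<psi> \<phi>"
  note cats = qdistributorD(1)[OF \<phi>] qdistributorD(2)[OF \<phi>] qdistributorD(2)[OF \<psi>]
  note typing = cats[THEN ty_in_Ob] cats[THEN arr_in_hom] dcomp_in_hom
    qdistributor_in_hom[OF \<phi>] qdistributor_in_hom[OF \<psi>] Comp_closed
  show "qcategory Q \<A>" "qcategory Q \<C>" by (fact cats)+
  show "?d x z \<in> hom (ty \<A> x) (ty \<C> z)" if "x \<in> obs \<A>" "z \<in> obs \<C>" for x z
    using that by (rule dcomp_in_hom)
  show "?d x z = undefined" if "\<not> (x \<in> obs \<A> \<and> z \<in> obs \<C>)" for x z
    using that by (auto simp: dcomp_def)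
  (* An arrow distributes over the join that defines the composite; in residuated form, the
     inequality is tested on each member of the join. *)
  show "Comp Q (ty \<A> x) (ty \<C> z') (ty \<C> z) (arr \<C> z' z) (?d x z') \<preceq>\<langle>ty \<A> x,ty \<C> z\<rangle> ?d x z"
    if o: "x \<in> obs \<A>" "z' \<in> obs \<C>" "z \<in> obs \<C>" for x z' z
  proof -
    have "Comp Q (ty \<A> x) (ty \<B> y) (ty \<C> z') (\<psi> y z') (\<phi> x y) \<preceq>\<langle>ty \<A> x,ty \<C> z'\<rangle>
        rimp Q (ty \<A> x) (ty \<C> z') (ty \<C> z) (arr \<C> z' z) (?d x z)" if y: "y \<in> obs \<B>" for y
    proof -
      have "Comp Q (ty \<A> x) (ty \<C> z') (ty \<C> z) (arr \<C> z' z)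
          (Comp Q (ty \<A> x) (ty \<B> y) (ty \<C> z') (\<psi> y z') (\<phi> x y))
        = Comp Q (ty \<A> x) (ty \<B> y) (ty \<C> z)
          (Comp Q (ty \<B> y) (ty \<C> z') (ty \<C> z) (arr \<C> z' z) (\<psi> y z')) (\<phi> x y)"
        using o y by (simp add: Comp_assoc typing)
      also have "\<dots> \<preceq>\<langle>ty \<A> x,ty \<C> z\<rangle> Comp Q (ty \<A> x) (ty \<B> y) (ty \<C> z) (\<psi> y z) (\<phi> x y)"
        using o y by (intro Comp_mono_left qdistributor_cod_action[OF \<psi>] typing)
      also have "\<dots> \<preceq>\<langle>ty \<A> x,ty \<C> z\<rangle> ?d x z"
        using o y by (intro Comp_below_dcomp)
      finally show ?thesis
        using o y by (simp add: below_rimp_iff typing)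
    qed
    then have "?d x z' \<preceq>\<langle>ty \<A> x,ty \<C> z'\<rangle>
        rimp Q (ty \<A> x) (ty \<C> z') (ty \<C> z) (arr \<C> z' z) (?d x z)"
      using o by (simp add: dcomp_below_iff rimp_closed typing)
    then show ?thesis
      using o by (simp add: below_rimp_iff typing)
  qed
  show "Comp Q (ty \<A> x) (ty \<A> x') (ty \<C> z) (?d x' z) (arr \<A> x x') \<preceq>\<langle>ty \<A> x,ty \<C> z\<rangle> ?d x z"
    if o: "x \<in> obs \<A>" "x' \<in> obs \<A>" "z \<in> obs \<C>" for x x' z
  proof -
    have "Comp Q (ty \<A> x') (ty \<B> y) (ty \<C> z) (\<psi> y z) (\<phi> x' y) \<preceq>\<langle>ty \<A> x',ty \<C> z\<rangle>
        limp Q (ty \<A> x) (ty \<A> x') (ty \<C> z) (?d x z) (arr \<A> x x')" if y: "y \<in> obs \<B>" for y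
    proof -
      have "Comp Q (ty \<A> x) (ty \<A> x') (ty \<C> z)
          (Comp Q (ty \<A> x') (ty \<B> y) (ty \<C> z) (\<psi> y z) (\<phi> x' y)) (arr \<A> x x')
        = Comp Q (ty \<A> x) (ty \<B> y) (ty \<C> z) (\<psi> y z)
          (Comp Q (ty \<A> x) (ty \<A> x') (ty \<B> y) (\<phi> x' y) (arr \<A> x x'))"
        using o y by (simp add: Comp_assoc typing)
      also have "\<dots> \<preceq>\<langle>ty \<A> x,ty \<C> z\<rangle> Comp Q (ty \<A> x) (ty \<B> y) (ty \<C> z) (\<psi> y z) (\<phi> x y)"
        using o y by (intro Comp_mono_right qdistributor_dom_action[OF \<phi>] typing)
      also have "\<dots> \<preceq>\<langle>ty \<A> x,ty \<C> z\<rangle> ?d x z"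
        using o y by (intro Comp_below_dcomp)
      finally show ?thesis
        using o y by (simp add: below_limp_iff typing)
    qed
    then have "?d x' z \<preceq>\<langle>ty \<A> x',ty \<C> z\<rangle>
        limp Q (ty \<A> x) (ty \<A> x') (ty \<C> z) (?d x z) (arr \<A> x x')"
      using o by (simp add: dcomp_below_iff limp_closed typing)
    then show ?thesis
      using o by (simp add: below_limp_iff typing)
  qed
qed

end

context
  fixes \<A> :: "('o, 'm, 'a) qcat_data" and \<B> :: "('o, 'm, 'b) qcat_data"
    and \<C> :: "('o, 'm, 'c) qcat_data" and \<phi> \<eta>
  assumes \<phi>: "qdistributor Q \<A> \<B> \<phi>" and \<eta>: "qdistributor Q \<A> \<C> \<eta>"
begin

lemma below_dlimp_iff:
  assumes "y \<in> obs \<B>" "z \<in> obs \<C>" "h \<in> hom (ty \<B> y) (ty \<C> z)"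
  shows "h \<preceq>\<langle>ty \<B> y,ty \<C> z\<rangle> dlimp Q \<A> \<B> \<C> \<eta> \<phi> y z \<longleftrightarrow>
    (\<forall>x\<in>obs \<A>. Comp Q (ty \<A> x) (ty \<B> y) (ty \<C> z) h (\<phi> x y) \<preceq>\<langle>ty \<A> x,ty \<C> z\<rangle> \<eta> x z)"
  using assms qdistributorD(1-3)[OF \<phi>] qdistributorD(1-3)[OF \<eta>]
  by (simp add: dlimp_def below_Inf_iff image_subset_iff ty_in_Ob Comp_closed limp_closed below_limp_iff)

lemma dlimp_in_hom:
  assumes "y \<in> obs \<B>" "z \<in> obs \<C>"
  shows "dlimp Q \<A> \<B> \<C> \<eta> \<phi> y z \<in> hom (ty \<B> y) (ty \<C> z)"
  using assms qdistributorD(1-3)[OF \<phi>] qdistributorD(1-3)[OF \<eta>]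
  by (simp add: dlimp_def Inf_closed image_subset_iff ty_in_Ob Comp_closed limp_closed)

lemma Comp_dlimp_below:
  assumes "x \<in> obs \<A>" "y \<in> obs \<B>" "z \<in> obs \<C>"
  shows "Comp Q (ty \<A> x) (ty \<B> y) (ty \<C> z) (dlimp Q \<A> \<B> \<C> \<eta> \<phi> y z) (\<phi> x y)
    \<preceq>\<langle>ty \<A> x,ty \<C> z\<rangle> \<eta> x z"
  using below_dlimp_iff[of y z "dlimp Q \<A> \<B> \<C> \<eta> \<phi> y z"] assms
    below_refl[OF ty_in_Ob[OF qdistributorD(2)[OF \<phi>]] ty_in_Ob[OF qdistributorD(2)[OF \<eta>]] dlimp_in_hom]
    dlimp_in_hom by blast

text \<open>
  By \<open>below_dlimp_iff\<close> each action is tested after composition with \<open>\<phi> x y\<close>, where it is absorbed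
  by the action on \<open>\<eta>\<close> (at \<open>\<C>\<close>) or by the action on \<open>\<phi>\<close> (at \<open>\<B>\<close>). The case of \<open>drimp\<close> is dual.
\<close>

lemma dlimp_qdistributor: "qdistributor Q \<B> \<C> (dlimp Q \<A> \<B> \<C> \<eta> \<phi>)"
  unfolding qdistributor_iff
proof (intro conjI ballI allI impI)
  let ?l = "dlimp Q \<A> \<B> \<C> \<eta> \<phi>"
  note cats = qdistributorD(1)[OF \<phi>] qdistributorD(2)[OF \<phi>] qdistributorD(2)[OF \<eta>]
  note typing = cats[THEN ty_in_Ob] cats[THEN arr_in_hom] dlimp_in_hom
    qdistributor_in_hom[OF \<phi>] qdistributor_in_hom[OF \<eta>] Comp_closed
  show "qcategory Q \<B>" "qcategory Q \<C>" by (fact cats)+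
  show "?l y z \<in> hom (ty \<B> y) (ty \<C> z)" if "y \<in> obs \<B>" "z \<in> obs \<C>" for y z
    using that by (rule dlimp_in_hom)
  show "?l y z = undefined" if "\<not> (y \<in> obs \<B> \<and> z \<in> obs \<C>)" for y z
    using that by (auto simp: dlimp_def)
  show "Comp Q (ty \<B> y) (ty \<C> z') (ty \<C> z) (arr \<C> z' z) (?l y z') \<preceq>\<langle>ty \<B> y,ty \<C> z\<rangle> ?l y z"
    if o: "y \<in> obs \<B>" "z' \<in> obs \<C>" "z \<in> obs \<C>" for y z' z
  proof -
    have "Comp Q (ty \<A> x) (ty \<B> y) (ty \<C> z)
        (Comp Q (ty \<B> y) (ty \<C> z') (ty \<C> z) (arr \<C> z' z) (?l y z')) (\<phi> x y)
        \<preceq>\<langle>ty \<A> x,ty \<C> z\<rangle> \<eta> x z" if x: "x \<in> obs \<A>" for x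
    proof -
      have "Comp Q (ty \<A> x) (ty \<B> y) (ty \<C> z)
          (Comp Q (ty \<B> y) (ty \<C> z') (ty \<C> z) (arr \<C> z' z) (?l y z')) (\<phi> x y)
        = Comp Q (ty \<A> x) (ty \<C> z') (ty \<C> z) (arr \<C> z' z)
          (Comp Q (ty \<A> x) (ty \<B> y) (ty \<C> z') (?l y z') (\<phi> x y))"
        using o x by (simp add: Comp_assoc typing)
      also have "\<dots> \<preceq>\<langle>ty \<A> x,ty \<C> z\<rangle> Comp Q (ty \<A> x) (ty \<C> z') (ty \<C> z) (arr \<C> z' z) (\<eta> x z')"
        using o x by (intro Comp_mono_right Comp_dlimp_below typing)
      also have "\<dots> \<preceq>\<langle>ty \<A> x,ty \<C> z\<rangle> \<eta> x z"
        using o x by (intro qdistributor_cod_action[OF \<eta>])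
      finally show ?thesis .
    qed
    then show ?thesis using o by (simp add: below_dlimp_iff typing)
  qed
  show "Comp Q (ty \<B> y) (ty \<B> y') (ty \<C> z) (?l y' z) (arr \<B> y y') \<preceq>\<langle>ty \<B> y,ty \<C> z\<rangle> ?l y z"
    if o: "y \<in> obs \<B>" "y' \<in> obs \<B>" "z \<in> obs \<C>" for y y' z
  proof -
    have "Comp Q (ty \<A> x) (ty \<B> y) (ty \<C> z)
        (Comp Q (ty \<B> y) (ty \<B> y') (ty \<C> z) (?l y' z) (arr \<B> y y')) (\<phi> x y)
        \<preceq>\<langle>ty \<A> x,ty \<C> z\<rangle> \<eta> x z" if x: "x \<in> obs \<A>" for x
    proof -
      have "Comp Q (ty \<A> x) (ty \<B> y) (ty \<C> z)
          (Comp Q (ty \<B> y) (ty \<B> y') (ty \<C> z) (?l y' z) (arr \<B> y y')) (\<phi> x y)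
        = Comp Q (ty \<A> x) (ty \<B> y') (ty \<C> z) (?l y' z)
          (Comp Q (ty \<A> x) (ty \<B> y) (ty \<B> y') (arr \<B> y y') (\<phi> x y))"
        using o x by (simp add: Comp_assoc typing)
      also have "\<dots> \<preceq>\<langle>ty \<A> x,ty \<C> z\<rangle> Comp Q (ty \<A> x) (ty \<B> y') (ty \<C> z) (?l y' z) (\<phi> x y')"
        using o x by (intro Comp_mono_right qdistributor_cod_action[OF \<phi>] typing)
      also have "\<dots> \<preceq>\<langle>ty \<A> x,ty \<C> z\<rangle> \<eta> x z"
        using o x by (intro Comp_dlimp_below)
      finally show ?thesis .
    qed
    then show ?thesis using o by (simp add: below_dlimp_iff typing)
  qed
qed

end

context
  fixes \<A> :: "('o, 'm, 'a) qcat_data" and \<B> :: "('o, 'm, 'b) qcat_data"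
    and \<C> :: "('o, 'm, 'c) qcat_data" and \<psi> \<eta>
  assumes \<psi>: "qdistributor Q \<B> \<C> \<psi>" and \<eta>: "qdistributor Q \<A> \<C> \<eta>"
begin

lemma below_drimp_iff:
  assumes "x \<in> obs \<A>" "y \<in> obs \<B>" "h \<in> hom (ty \<A> x) (ty \<B> y)"
  shows "h \<preceq>\<langle>ty \<A> x,ty \<B> y\<rangle> drimp Q \<A> \<B> \<C> \<psi> \<eta> x y \<longleftrightarrow>
    (\<forall>z\<in>obs \<C>. Comp Q (ty \<A> x) (ty \<B> y) (ty \<C> z) (\<psi> y z) h \<preceq>\<langle>ty \<A> x,ty \<C> z\<rangle> \<eta> x z)"
  using assms qdistributorD(1-3)[OF \<psi>] qdistributorD(1-3)[OF \<eta>]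
  by (simp add: drimp_def below_Inf_iff image_subset_iff ty_in_Ob Comp_closed rimp_closed below_rimp_iff)

lemma drimp_in_hom:
  assumes "x \<in> obs \<A>" "y \<in> obs \<B>"
  shows "drimp Q \<A> \<B> \<C> \<psi> \<eta> x y \<in> hom (ty \<A> x) (ty \<B> y)"
  using assms qdistributorD(1-3)[OF \<psi>] qdistributorD(1-3)[OF \<eta>]
  by (simp add: drimp_def Inf_closed image_subset_iff ty_in_Ob Comp_closed rimp_closed)

lemma Comp_drimp_below:
  assumes "x \<in> obs \<A>" "y \<in> obs \<B>" "z \<in> obs \<C>"
  shows "Comp Q (ty \<A> x) (ty \<B> y) (ty \<C> z) (\<psi> y z) (drimp Q \<A> \<B> \<C> \<psi> \<eta> x y)
    \<preceq>\<langle>ty \<A> x,ty \<C> z\<rangle> \<eta> x z"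
  using below_drimp_iff[of x y "drimp Q \<A> \<B> \<C> \<psi> \<eta> x y"] assms
    below_refl[OF ty_in_Ob[OF qdistributorD(1)[OF \<eta>]] ty_in_Ob[OF qdistributorD(1)[OF \<psi>]] drimp_in_hom]
    drimp_in_hom by blast

lemma drimp_qdistributor: "qdistributor Q \<A> \<B> (drimp Q \<A> \<B> \<C> \<psi> \<eta>)"
  unfolding qdistributor_iff
proof (intro conjI ballI allI impI)
  let ?r = "drimp Q \<A> \<B> \<C> \<psi> \<eta>"
  note cats = qdistributorD(1)[OF \<eta>] qdistributorD(1)[OF \<psi>] qdistributorD(2)[OF \<psi>]
  note typing = cats[THEN ty_in_Ob] cats[THEN arr_in_hom] drimp_in_hom
    qdistributor_in_hom[OF \<psi>] qdistributor_in_hom[OF \<eta>] Comp_closed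
  show "qcategory Q \<A>" "qcategory Q \<B>" by (fact cats)+
  show "?r x y \<in> hom (ty \<A> x) (ty \<B> y)" if "x \<in> obs \<A>" "y \<in> obs \<B>" for x y
    using that by (rule drimp_in_hom)
  show "?r x y = undefined" if "\<not> (x \<in> obs \<A> \<and> y \<in> obs \<B>)" for x y
    using that by (auto simp: drimp_def)
  show "Comp Q (ty \<A> x) (ty \<B> y') (ty \<B> y) (arr \<B> y' y) (?r x y') \<preceq>\<langle>ty \<A> x,ty \<B> y\<rangle> ?r x y"
    if o: "x \<in> obs \<A>" "y' \<in> obs \<B>" "y \<in> obs \<B>" for x y' y
  proof -
    have "Comp Q (ty \<A> x) (ty \<B> y) (ty \<C> z) (\<psi> y z)
        (Comp Q (ty \<A> x) (ty \<B> y') (ty \<B> y) (arr \<B> y' y) (?r x y'))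
        \<preceq>\<langle>ty \<A> x,ty \<C> z\<rangle> \<eta> x z" if z: "z \<in> obs \<C>" for z
    proof -
      have "Comp Q (ty \<A> x) (ty \<B> y) (ty \<C> z) (\<psi> y z)
          (Comp Q (ty \<A> x) (ty \<B> y') (ty \<B> y) (arr \<B> y' y) (?r x y'))
        = Comp Q (ty \<A> x) (ty \<B> y') (ty \<C> z)
          (Comp Q (ty \<B> y') (ty \<B> y) (ty \<C> z) (\<psi> y z) (arr \<B> y' y)) (?r x y')"
        using o z by (simp add: Comp_assoc typing)
      also have "\<dots> \<preceq>\<langle>ty \<A> x,ty \<C> z\<rangle> Comp Q (ty \<A> x) (ty \<B> y') (ty \<C> z) (\<psi> y' z) (?r x y')"
        using o z by (intro Comp_mono_left qdistributor_dom_action[OF \<psi>] typing)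
      also have "\<dots> \<preceq>\<langle>ty \<A> x,ty \<C> z\<rangle> \<eta> x z"
        using o z by (intro Comp_drimp_below)
      finally show ?thesis .
    qed
    then show ?thesis using o by (simp add: below_drimp_iff typing)
  qed
  show "Comp Q (ty \<A> x) (ty \<A> x') (ty \<B> y) (?r x' y) (arr \<A> x x') \<preceq>\<langle>ty \<A> x,ty \<B> y\<rangle> ?r x y"
    if o: "x \<in> obs \<A>" "x' \<in> obs \<A>" "y \<in> obs \<B>" for x x' y
  proof -
    have "Comp Q (ty \<A> x) (ty \<B> y) (ty \<C> z) (\<psi> y z)
        (Comp Q (ty \<A> x) (ty \<A> x') (ty \<B> y) (?r x' y) (arr \<A> x x'))
        \<preceq>\<langle>ty \<A> x,ty \<C> z\<rangle> \<eta> x z" if z: "z \<in> obs \<C>" for z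
    proof -
      have "Comp Q (ty \<A> x) (ty \<B> y) (ty \<C> z) (\<psi> y z)
          (Comp Q (ty \<A> x) (ty \<A> x') (ty \<B> y) (?r x' y) (arr \<A> x x'))
        = Comp Q (ty \<A> x) (ty \<A> x') (ty \<C> z)
          (Comp Q (ty \<A> x') (ty \<B> y) (ty \<C> z) (\<psi> y z) (?r x' y)) (arr \<A> x x')"
        using o z by (simp add: Comp_assoc typing)
      also have "\<dots> \<preceq>\<langle>ty \<A> x,ty \<C> z\<rangle> Comp Q (ty \<A> x) (ty \<A> x') (ty \<C> z) (\<eta> x' z) (arr \<A> x x')"
        using o z by (intro Comp_mono_left Comp_drimp_below typing)
      also have "\<dots> \<preceq>\<langle>ty \<A> x,ty \<C> z\<rangle> \<eta> x z"
        using o z by (intro qdistributor_dom_action[OF \<eta>])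
      finally show ?thesis .
    qed
    then show ?thesis using o by (simp add: below_drimp_iff typing)
  qed
qed

end

section \<open>Graphs and cographs\<close>

lemma qfunctorD:
  assumes "qfunctor Q \<A> \<B> F"
  shows qfunctor_dom: "qcategory Q \<A>"
    and qfunctor_cod: "qcategory Q \<B>"
    and qfunctor_obs: "x \<in> obs \<A> \<Longrightarrow> F x \<in> obs \<B>"
    and qfunctor_ty: "x \<in> obs \<A> \<Longrightarrow> ty \<B> (F x) = ty \<A> x"
    and qfunctor_arr: "x \<in> obs \<A> \<Longrightarrow> x' \<in> obs \<A> \<Longrightarrow>
        arr \<A> x x' \<preceq>\<langle>ty \<A> x,ty \<A> x'\<rangle> arr \<B> (F x) (F x')"
proof -
  show *: "qcategory Q \<A>" "qcategory Q \<B>" using assms by (auto simp: qfunctor_def)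
  show **: "F x \<in> obs \<B>" "ty \<B> (F x) = ty \<A> x" if "x \<in> obs \<A>" for x
    using assms that by (auto simp: qfunctor_def)
  show "arr \<A> x x' \<preceq>\<langle>ty \<A> x,ty \<A> x'\<rangle> arr \<B> (F x) (F x')" if "x \<in> obs \<A>" "x' \<in> obs \<A>"
    using assms that ** arr_in_hom[OF *(2), of "F x" "F x'"] *(1)
    by (simp add: qfunctor_def below_def ty_in_Ob arr_in_hom)
qed

context
  fixes \<A> :: "('o, 'm, 'a) qcat_data" and \<B> :: "('o, 'm, 'b) qcat_data" and F
  assumes F: "qfunctor Q \<A> \<B> F"
begin

lemma arr_image_in_hom:
  assumes "x \<in> obs \<A>" "y \<in> obs \<B>"
  shows "arr \<B> (F x) y \<in> hom (ty \<A> x) (ty \<B> y)" "arr \<B> y (F x) \<in> hom (ty \<B> y) (ty \<A> x)"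
  using assms arr_in_hom[OF qfunctor_cod[OF F], of "F x" y]
    arr_in_hom[OF qfunctor_cod[OF F], of y "F x"]
  by (simp_all add: qfunctor_obs[OF F] qfunctor_ty[OF F])

lemma Idn_below_arr_image:
  assumes "x \<in> obs \<A>"
  shows "Idn Q (ty \<A> x) \<preceq>\<langle>ty \<A> x,ty \<A> x\<rangle> arr \<B> (F x) (F x)"
  using assms Idn_below_arr[OF qfunctor_cod[OF F], of "F x"]
  by (simp add: qfunctor_obs[OF F] qfunctor_ty[OF F])

lemma graph_qdistributor: "qdistributor Q \<A> \<B> (graph \<A> \<B> F)"
  unfolding qdistributor_iff
proof (intro conjI ballI allI impI)
  note cats = qfunctor_dom[OF F] qfunctor_cod[OF F]
  note typing = cats[THEN ty_in_Ob] cats[THEN arr_in_hom] arr_image_in_hom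
  show "qcategory Q \<A>" "qcategory Q \<B>" by (fact cats)+
  show "graph \<A> \<B> F x y \<in> hom (ty \<A> x) (ty \<B> y)" if "x \<in> obs \<A>" "y \<in> obs \<B>" for x y
    using that by (simp add: graph_def typing)
  show "graph \<A> \<B> F x y = undefined" if "\<not> (x \<in> obs \<A> \<and> y \<in> obs \<B>)" for x y
    using that by (auto simp: graph_def)
  show "Comp Q (ty \<A> x) (ty \<B> y') (ty \<B> y) (arr \<B> y' y) (graph \<A> \<B> F x y')
      \<preceq>\<langle>ty \<A> x,ty \<B> y\<rangle> graph \<A> \<B> F x y"
    if "x \<in> obs \<A>" "y' \<in> obs \<B>" "y \<in> obs \<B>" for x y' y
    using that Comp_arr_below[OF cats(2), of "F x" y' y]
    by (simp add: graph_def qfunctor_obs[OF F] qfunctor_ty[OF F])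
  show "Comp Q (ty \<A> x) (ty \<A> x') (ty \<B> y) (graph \<A> \<B> F x' y) (arr \<A> x x')
      \<preceq>\<langle>ty \<A> x,ty \<B> y\<rangle> graph \<A> \<B> F x y"
    if o: "x \<in> obs \<A>" "x' \<in> obs \<A>" "y \<in> obs \<B>" for x x' y
  proof -
    have "Comp Q (ty \<A> x) (ty \<A> x') (ty \<B> y) (arr \<B> (F x') y) (arr \<A> x x') \<preceq>\<langle>ty \<A> x,ty \<B> y\<rangle>
        Comp Q (ty \<A> x) (ty \<A> x') (ty \<B> y) (arr \<B> (F x') y) (arr \<B> (F x) (F x'))"
      using o by (intro Comp_mono_right qfunctor_arr[OF F] typing)
    also have "\<dots> \<preceq>\<langle>ty \<A> x,ty \<B> y\<rangle> arr \<B> (F x) y"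
      using o Comp_arr_below[OF cats(2), of "F x" "F x'" y]
      by (simp add: qfunctor_obs[OF F] qfunctor_ty[OF F])
    finally show ?thesis using o by (simp add: graph_def)
  qed
qed

lemma cograph_qdistributor: "qdistributor Q \<B> \<A> (cograph \<A> \<B> F)"
  unfolding qdistributor_iff
proof (intro conjI ballI allI impI)
  note cats = qfunctor_dom[OF F] qfunctor_cod[OF F]
  note typing = cats[THEN ty_in_Ob] cats[THEN arr_in_hom] arr_image_in_hom
  show "qcategory Q \<B>" "qcategory Q \<A>" by (fact cats)+
  show "cograph \<A> \<B> F y x \<in> hom (ty \<B> y) (ty \<A> x)" if "y \<in> obs \<B>" "x \<in> obs \<A>" for y x
    using that by (simp add: cograph_def typing)
  show "cograph \<A> \<B> F y x = undefined" if "\<not> (y \<in> obs \<B> \<and> x \<in> obs \<A>)" for y x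
    using that by (auto simp: cograph_def)
  show "Comp Q (ty \<B> y) (ty \<A> x') (ty \<A> x) (arr \<A> x' x) (cograph \<A> \<B> F y x')
      \<preceq>\<langle>ty \<B> y,ty \<A> x\<rangle> cograph \<A> \<B> F y x"
    if o: "y \<in> obs \<B>" "x' \<in> obs \<A>" "x \<in> obs \<A>" for y x' x
  proof -
    have "Comp Q (ty \<B> y) (ty \<A> x') (ty \<A> x) (arr \<A> x' x) (arr \<B> y (F x')) \<preceq>\<langle>ty \<B> y,ty \<A> x\<rangle>
        Comp Q (ty \<B> y) (ty \<A> x') (ty \<A> x) (arr \<B> (F x') (F x)) (arr \<B> y (F x'))"
      using o by (intro Comp_mono_left qfunctor_arr[OF F] typing)
    also have "\<dots> \<preceq>\<langle>ty \<B> y,ty \<A> x\<rangle> arr \<B> y (F x)"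
      using o Comp_arr_below[OF cats(2), of y "F x'" "F x"]
      by (simp add: qfunctor_obs[OF F] qfunctor_ty[OF F])
    finally show ?thesis using o by (simp add: cograph_def)
  qed
  show "Comp Q (ty \<B> y) (ty \<B> y') (ty \<A> x) (cograph \<A> \<B> F y' x) (arr \<B> y y')
      \<preceq>\<langle>ty \<B> y,ty \<A> x\<rangle> cograph \<A> \<B> F y x"
    if "y \<in> obs \<B>" "y' \<in> obs \<B>" "x \<in> obs \<A>" for y y' x
    using that Comp_arr_below[OF cats(2), of y y' "F x"]
    by (simp add: cograph_def qfunctor_obs[OF F] qfunctor_ty[OF F])
qed

text \<open>
  A Yoneda argument: each member of the join is bounded by the action of \<open>\<B>\<close>, and the identity
  at \<open>F x\<close> shows that the bound is attained.
\<close>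

lemma dcomp_graph:
  assumes \<psi>: "qdistributor Q \<B> \<C> \<psi>" and o: "x \<in> obs \<A>" "z \<in> obs \<C>"
  shows "dcomp Q \<A> \<B> \<C> \<psi> (graph \<A> \<B> F) x z = \<psi> (F x) z"
proof (rule below_antisym)
  note G = graph_qdistributor
  have Fx: "F x \<in> obs \<B>" "ty \<B> (F x) = ty \<A> x" using o qfunctorD[OF F] by auto
  have t: "ty \<A> x \<in> Ob Q" "ty \<C> z \<in> Ob Q" "\<psi> (F x) z \<in> hom (ty \<A> x) (ty \<C> z)"
    using o Fx qdistributor_in_hom[OF \<psi>, of "F x" z]
    by (simp_all add: ty_in_Ob[OF qfunctor_dom[OF F]] ty_in_Ob[OF qdistributor_cod[OF \<psi>]])
  show "dcomp Q \<A> \<B> \<C> \<psi> (graph \<A> \<B> F) x z \<preceq>\<langle>ty \<A> x,ty \<C> z\<rangle> \<psi> (F x) z"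
    unfolding dcomp_below_iff[OF G \<psi> o t(3)]
    using o Fx qdistributor_dom_action[OF \<psi> Fx(1) _ o(2)] by (simp add: graph_def)
  have "\<psi> (F x) z = Comp Q (ty \<A> x) (ty \<A> x) (ty \<C> z) (\<psi> (F x) z) (Idn Q (ty \<A> x))"
    using t by (simp add: Comp_Idn_right)
  also have "\<dots> \<preceq>\<langle>ty \<A> x,ty \<C> z\<rangle>
      Comp Q (ty \<A> x) (ty \<A> x) (ty \<C> z) (\<psi> (F x) z) (arr \<B> (F x) (F x))"
    using o t by (intro Comp_mono_right Idn_below_arr_image)
  also have "\<dots> \<preceq>\<langle>ty \<A> x,ty \<C> z\<rangle> dcomp Q \<A> \<B> \<C> \<psi> (graph \<A> \<B> F) x z"
    using Comp_below_dcomp[OF G \<psi> o(1) Fx(1) o(2)] o Fx by (simp add: graph_def)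
  finally show "\<psi> (F x) z \<preceq>\<langle>ty \<A> x,ty \<C> z\<rangle> dcomp Q \<A> \<B> \<C> \<psi> (graph \<A> \<B> F) x z" .
qed

lemma dcomp_cograph:
  assumes \<phi>: "qdistributor Q \<C> \<B> \<phi>" and o: "z \<in> obs \<C>" "x \<in> obs \<A>"
  shows "dcomp Q \<C> \<B> \<A> (cograph \<A> \<B> F) \<phi> z x = \<phi> z (F x)"
proof (rule below_antisym)
  note G = cograph_qdistributor
  have Fx: "F x \<in> obs \<B>" "ty \<B> (F x) = ty \<A> x" using o qfunctorD[OF F] by auto
  have t: "ty \<A> x \<in> Ob Q" "ty \<C> z \<in> Ob Q" "\<phi> z (F x) \<in> hom (ty \<C> z) (ty \<A> x)"
    using o Fx qdistributor_in_hom[OF \<phi>, of z "F x"]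
    by (simp_all add: ty_in_Ob[OF qfunctor_dom[OF F]] ty_in_Ob[OF qdistributor_dom[OF \<phi>]])
  show "dcomp Q \<C> \<B> \<A> (cograph \<A> \<B> F) \<phi> z x \<preceq>\<langle>ty \<C> z,ty \<A> x\<rangle> \<phi> z (F x)"
    unfolding dcomp_below_iff[OF \<phi> G o t(3)]
    using o Fx qdistributor_cod_action[OF \<phi> o(1) _ Fx(1)] by (simp add: cograph_def)
  have "\<phi> z (F x) = Comp Q (ty \<C> z) (ty \<A> x) (ty \<A> x) (Idn Q (ty \<A> x)) (\<phi> z (F x))"
    using t by (simp add: Comp_Idn_left)
  also have "\<dots> \<preceq>\<langle>ty \<C> z,ty \<A> x\<rangle>
      Comp Q (ty \<C> z) (ty \<A> x) (ty \<A> x) (arr \<B> (F x) (F x)) (\<phi> z (F x))"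
    using o t by (intro Comp_mono_left Idn_below_arr_image)
  also have "\<dots> \<preceq>\<langle>ty \<C> z,ty \<A> x\<rangle> dcomp Q \<C> \<B> \<A> (cograph \<A> \<B> F) \<phi> z x"
    using Comp_below_dcomp[OF \<phi> G o(1) Fx(1) o(2)] o Fx by (simp add: cograph_def)
  finally show "\<phi> z (F x) \<preceq>\<langle>ty \<C> z,ty \<A> x\<rangle> dcomp Q \<C> \<B> \<A> (cograph \<A> \<B> F) \<phi> z x" .
qed

end

lemma infomorphism_components:
  assumes "infomorphism Q \<A> \<B> \<phi> \<A>' \<B>' \<psi> F G" "x \<in> obs \<A>" "y \<in> obs \<B>'"
  shows "\<phi> x (G y) = \<psi> (F x) y"
proof -
  have "qdistributor Q \<A> \<B> \<phi>" "qdistributor Q \<A>' \<B>' \<psi>" "qfunctor Q \<A> \<A>' F" "qfunctor Q \<B>' \<B> G"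
    and eq: "dcomp Q \<A> \<B> \<B>' (cograph \<B>' \<B> G) \<phi> = dcomp Q \<A> \<A>' \<B>' \<psi> (graph \<A> \<A>' F)"
    using assms(1) by (auto simp: infomorphism_def)
  then show ?thesis
    using dcomp_cograph[of \<B>' \<B> G \<A> \<phi> x y] dcomp_graph[of \<A> \<A>' F \<B>' \<psi> x y] assms(2,3) by simp
qed

section \<open>The category of presheaves\<close>

lemma star_simps [simp]:
  "obs (star Q X) = {()}" "ty (star Q X) u = X" "arr (star Q X) u v = Idn Q X"
  by (simp_all add: star_def)

lemma ty_presheaf [simp]: "ty (presheaves Q \<A>) (X, \<mu>) = X"
  by (simp add: presheaves_def)

lemma arr_presheaves:
  "arr (presheaves Q \<A>) (X, \<mu>) (Y, \<nu>) = dlimp Q \<A> (star Q X) (star Q Y) \<nu> \<mu> () ()"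
  by (simp add: presheaves_def)

lemma presheaf_iff:
  "(X, \<mu>) \<in> obs (presheaves Q \<A>) \<longleftrightarrow> X \<in> Ob Q \<and> qdistributor Q \<A> (star Q X) \<mu>"
  by (simp add: presheaves_def)

lemma presheaf_in_hom:
  "(X, \<mu>) \<in> obs (presheaves Q \<A>) \<Longrightarrow> x \<in> obs \<A> \<Longrightarrow> \<mu> x () \<in> hom (ty \<A> x) X"
  using qdistributor_in_hom[of \<A> "star Q X" \<mu> x "()"] by (simp add: presheaf_iff)

context
  fixes \<A> :: "('o, 'm, 'a) qcat_data" and X Y :: 'o and \<mu> \<nu>
  assumes \<mu>: "(X, \<mu>) \<in> obs (presheaves Q \<A>)" and \<nu>: "(Y, \<nu>) \<in> obs (presheaves Q \<A>)"
begin

lemma presheaf_arr_in_hom: "arr (presheaves Q \<A>) (X, \<mu>) (Y, \<nu>) \<in> hom X Y"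
  using dlimp_in_hom[of \<A> "star Q X" \<mu> "star Q Y" \<nu> "()" "()"] \<mu> \<nu>
  by (simp add: presheaf_iff arr_presheaves)

lemma below_presheaf_arr_iff:
  assumes "h \<in> hom X Y"
  shows "h \<preceq>\<langle>X,Y\<rangle> arr (presheaves Q \<A>) (X, \<mu>) (Y, \<nu>) \<longleftrightarrow>
    (\<forall>x\<in>obs \<A>. Comp Q (ty \<A> x) X Y h (\<mu> x ()) \<preceq>\<langle>ty \<A> x,Y\<rangle> \<nu> x ())"
  using below_dlimp_iff[of \<A> "star Q X" \<mu> "star Q Y" \<nu> "()" "()" h] \<mu> \<nu> assms
  by (simp add: presheaf_iff arr_presheaves)

lemma Comp_presheaf_arr_below:
  assumes "x \<in> obs \<A>"
  shows "Comp Q (ty \<A> x) X Y (arr (presheaves Q \<A>) (X, \<mu>) (Y, \<nu>)) (\<mu> x ()) \<preceq>\<langle>ty \<A> x,Y\<rangle> \<nu> x ()"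
  using Comp_dlimp_below[of \<A> "star Q X" \<mu> "star Q Y" \<nu> x "()" "()"] \<mu> \<nu> assms
  by (simp add: presheaf_iff arr_presheaves)

end

text \<open>
  The hom-arrow from \<open>\<mu>\<close> to \<open>\<nu>\<close> is the largest \<open>h\<close> with \<open>h \<circ> \<mu> x \<le> \<nu> x\<close>, so the identity lies
  below it exactly when \<open>\<mu>\<close> lies pointwise below \<open>\<nu>\<close>.
\<close>

lemma qle_presheaves_iff:
  assumes "(X, \<mu>) \<in> obs (presheaves Q \<A>)" "(X, \<nu>) \<in> obs (presheaves Q \<A>)"
  shows "qle Q (presheaves Q \<A>) (X, \<mu>) (X, \<nu>) \<longleftrightarrow> (\<forall>x\<in>obs \<A>. \<mu> x () \<preceq>\<langle>ty \<A> x,X\<rangle> \<nu> x ())"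
proof -
  have X: "X \<in> Ob Q" and \<A>: "qcategory Q \<A>"
    using assms(1) qdistributor_dom by (auto simp: presheaf_iff)
  have "qle Q (presheaves Q \<A>) (X, \<mu>) (X, \<nu>)
      \<longleftrightarrow> Idn Q X \<preceq>\<langle>X,X\<rangle> arr (presheaves Q \<A>) (X, \<mu>) (X, \<nu>)"
    using X presheaf_arr_in_hom[OF assms] by (simp add: qle_def below_def Idn_closed)
  also have "\<dots> \<longleftrightarrow> (\<forall>x\<in>obs \<A>. \<mu> x () \<preceq>\<langle>ty \<A> x,X\<rangle> \<nu> x ())"
    using X presheaf_in_hom[OF assms(1)]
    by (simp add: below_presheaf_arr_iff[OF assms] Idn_closed Comp_Idn_left ty_in_Ob[OF \<A>])
  finally show ?thesis .
qed

lemma qcategory_presheaves: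
  assumes \<A>: "qcategory Q \<A>"
  shows "qcategory Q (presheaves Q \<A>)"
proof -
  let ?P = "presheaves Q \<A>"
  have ty: "X \<in> Ob Q" if "(X, \<mu>) \<in> obs ?P" for X \<mu> using that by (simp add: presheaf_iff)
  have Idn: "Idn Q X \<preceq>\<langle>X,X\<rangle> arr ?P (X, \<mu>) (X, \<mu>)" if \<mu>: "(X, \<mu>) \<in> obs ?P" for X \<mu>
    using below_refl ty[OF \<mu>] presheaf_in_hom[OF \<mu>]
    by (simp add: below_presheaf_arr_iff[OF \<mu> \<mu>] Idn_closed Comp_Idn_left ty_in_Ob[OF \<A>])
  have Comp: "Comp Q X Y Z (arr ?P (Y, \<nu>) (Z, \<zeta>)) (arr ?P (X, \<mu>) (Y, \<nu>))
      \<preceq>\<langle>X,Z\<rangle> arr ?P (X, \<mu>) (Z, \<zeta>)"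
    if o: "(X, \<mu>) \<in> obs ?P" "(Y, \<nu>) \<in> obs ?P" "(Z, \<zeta>) \<in> obs ?P" for X Y Z \<mu> \<nu> \<zeta>
  proof -
    note typing = o[THEN ty] ty_in_Ob[OF \<A>] o[THEN presheaf_in_hom] Comp_closed
      presheaf_arr_in_hom[OF o(1,2)] presheaf_arr_in_hom[OF o(2,3)]
    have "Comp Q (ty \<A> x) X Z (Comp Q X Y Z (arr ?P (Y, \<nu>) (Z, \<zeta>)) (arr ?P (X, \<mu>) (Y, \<nu>))) (\<mu> x ())
        \<preceq>\<langle>ty \<A> x,Z\<rangle> \<zeta> x ()" if x: "x \<in> obs \<A>" for x
    proof -
      have "Comp Q (ty \<A> x) X Z (Comp Q X Y Z (arr ?P (Y, \<nu>) (Z, \<zeta>)) (arr ?P (X, \<mu>) (Y, \<nu>))) (\<mu> x ())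
        = Comp Q (ty \<A> x) Y Z (arr ?P (Y, \<nu>) (Z, \<zeta>))
            (Comp Q (ty \<A> x) X Y (arr ?P (X, \<mu>) (Y, \<nu>)) (\<mu> x ()))"
        using x by (simp add: Comp_assoc typing)
      also have "\<dots> \<preceq>\<langle>ty \<A> x,Z\<rangle> Comp Q (ty \<A> x) Y Z (arr ?P (Y, \<nu>) (Z, \<zeta>)) (\<nu> x ())"
        using x by (intro Comp_mono_right Comp_presheaf_arr_below o typing)
      also have "\<dots> \<preceq>\<langle>ty \<A> x,Z\<rangle> \<zeta> x ()"
        using x by (intro Comp_presheaf_arr_below o)
      finally show ?thesis .
    qed
    then show ?thesis by (simp add: below_presheaf_arr_iff[OF o(1,3)] typing)
  qed
  show ?thesis
    unfolding qcategory_iff using ty Idn Comp presheaf_arr_in_hom by auto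
qed

section \<open>The closure operator of a distributor\<close>

abbreviation isbell_closure where
  "isbell_closure \<A> \<B> \<phi> \<equiv> isbell_down Q \<A> \<B> \<phi> \<circ> isbell_up Q \<A> \<B> \<phi>"

text \<open>
  The underlying families of \<open>\<phi>\<^sub>\<up> \<mu>\<close> and \<open>\<phi>\<^sup>\<down> (\<phi>\<^sub>\<up> \<mu>)\<close> for a presheaf \<open>\<mu>\<close> of type \<open>X\<close>.
\<close>

abbreviation up where
  "up \<A> \<B> \<phi> X \<mu> \<equiv> dlimp Q \<A> (star Q X) \<B> \<phi> \<mu> ()"

abbreviation cl where
  "cl \<A> \<B> \<phi> X \<mu> \<equiv> drimp Q \<A> (star Q X) \<B> (dlimp Q \<A> (star Q X) \<B> \<phi> \<mu>) \<phi>"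

lemma isbell_closure_eq: "isbell_closure \<A> \<B> \<phi> (X, \<mu>) = (X, cl \<A> \<B> \<phi> X \<mu>)"
  by (simp add: isbell_down_def isbell_up_def)

context
  fixes \<A> :: "('o, 'm, 'a) qcat_data" and \<B> :: "('o, 'm, 'b) qcat_data" and \<phi> X \<mu>
  assumes \<phi>: "qdistributor Q \<A> \<B> \<phi>" and \<mu>: "(X, \<mu>) \<in> obs (presheaves Q \<A>)"
begin

lemma up_qdistributor: "qdistributor Q (star Q X) \<B> (dlimp Q \<A> (star Q X) \<B> \<phi> \<mu>)"
  using \<phi> \<mu> by (intro dlimp_qdistributor) (simp_all add: presheaf_iff)

lemma cl_presheaf: "(X, cl \<A> \<B> \<phi> X \<mu>) \<in> obs (presheaves Q \<A>)"
  using drimp_qdistributor[OF up_qdistributor \<phi>] \<mu> by (simp add: presheaf_iff)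

lemma up_in_hom: "y \<in> obs \<B> \<Longrightarrow> up \<A> \<B> \<phi> X \<mu> y \<in> hom X (ty \<B> y)"
  using dlimp_in_hom[of \<A> "star Q X" \<mu> \<B> \<phi> "()" y] \<phi> \<mu> by (simp add: presheaf_iff)

lemma below_up_iff:
  assumes "y \<in> obs \<B>" "h \<in> hom X (ty \<B> y)"
  shows "h \<preceq>\<langle>X,ty \<B> y\<rangle> up \<A> \<B> \<phi> X \<mu> y \<longleftrightarrow>
    (\<forall>x\<in>obs \<A>. Comp Q (ty \<A> x) X (ty \<B> y) h (\<mu> x ()) \<preceq>\<langle>ty \<A> x,ty \<B> y\<rangle> \<phi> x y)"
  using below_dlimp_iff[of \<A> "star Q X" \<mu> \<B> \<phi> "()" y h] \<phi> \<mu> assms by (simp add: presheaf_iff)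

lemma Comp_up_below:
  assumes "x \<in> obs \<A>" "y \<in> obs \<B>"
  shows "Comp Q (ty \<A> x) X (ty \<B> y) (up \<A> \<B> \<phi> X \<mu> y) (\<mu> x ()) \<preceq>\<langle>ty \<A> x,ty \<B> y\<rangle> \<phi> x y"
  using Comp_dlimp_below[of \<A> "star Q X" \<mu> \<B> \<phi> x "()" y] \<phi> \<mu> assms by (simp add: presheaf_iff)

lemma below_cl_iff:
  assumes "x \<in> obs \<A>" "h \<in> hom (ty \<A> x) X"
  shows "h \<preceq>\<langle>ty \<A> x,X\<rangle> cl \<A> \<B> \<phi> X \<mu> x () \<longleftrightarrow>
    (\<forall>y\<in>obs \<B>. Comp Q (ty \<A> x) X (ty \<B> y) (up \<A> \<B> \<phi> X \<mu> y) h \<preceq>\<langle>ty \<A> x,ty \<B> y\<rangle> \<phi> x y)"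
  using below_drimp_iff[OF up_qdistributor \<phi>, of x "()" h] assms by simp

lemma Comp_up_cl_below:
  assumes "x \<in> obs \<A>" "y \<in> obs \<B>"
  shows "Comp Q (ty \<A> x) X (ty \<B> y) (up \<A> \<B> \<phi> X \<mu> y) (cl \<A> \<B> \<phi> X \<mu> x ()) \<preceq>\<langle>ty \<A> x,ty \<B> y\<rangle> \<phi> x y"
  using Comp_drimp_below[OF up_qdistributor \<phi>, of x "()" y] assms by simp

lemma below_cl:
  assumes "x \<in> obs \<A>"
  shows "\<mu> x () \<preceq>\<langle>ty \<A> x,X\<rangle> cl \<A> \<B> \<phi> X \<mu> x ()"
  using assms presheaf_in_hom[OF \<mu>] Comp_up_below by (simp add: below_cl_iff)

end

context
  fixes \<A> :: "('o, 'm, 'a) qcat_data" and \<B> :: "('o, 'm, 'b) qcat_data" and \<phi>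
  assumes \<phi>: "qdistributor Q \<A> \<B> \<phi>"
begin

text \<open>
  A presheaf and its closure have the same image under \<open>\<phi>\<^sub>\<up>\<close>; the inequality below is the one that antitonicity
  does not give. It makes the second closure trivial.
\<close>

lemma up_below_up_cl:
  assumes \<mu>: "(X, \<mu>) \<in> obs (presheaves Q \<A>)" and y: "y \<in> obs \<B>"
  shows "up \<A> \<B> \<phi> X \<mu> y \<preceq>\<langle>X,ty \<B> y\<rangle> up \<A> \<B> \<phi> X (cl \<A> \<B> \<phi> X \<mu>) y"
  using y up_in_hom[OF \<phi> \<mu>] Comp_up_cl_below[OF \<phi> \<mu>]
  by (simp add: below_up_iff[OF \<phi> cl_presheaf[OF \<phi> \<mu>]])

lemma cl_cl_below:
  assumes \<mu>: "(X, \<mu>) \<in> obs (presheaves Q \<A>)" and x: "x \<in> obs \<A>"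
  shows "cl \<A> \<B> \<phi> X (cl \<A> \<B> \<phi> X \<mu>) x () \<preceq>\<langle>ty \<A> x,X\<rangle> cl \<A> \<B> \<phi> X \<mu> x ()"
proof -
  let ?c = "cl \<A> \<B> \<phi> X \<mu>"
  note c = cl_presheaf[OF \<phi> \<mu>]
  note cc = cl_presheaf[OF \<phi> c]
  have "Comp Q (ty \<A> x) X (ty \<B> y) (up \<A> \<B> \<phi> X \<mu> y) (cl \<A> \<B> \<phi> X ?c x ())
      \<preceq>\<langle>ty \<A> x,ty \<B> y\<rangle> \<phi> x y" if y: "y \<in> obs \<B>" for y
  proof -
    have "Comp Q (ty \<A> x) X (ty \<B> y) (up \<A> \<B> \<phi> X \<mu> y) (cl \<A> \<B> \<phi> X ?c x ())
      \<preceq>\<langle>ty \<A> x,ty \<B> y\<rangle> Comp Q (ty \<A> x) X (ty \<B> y) (up \<A> \<B> \<phi> X ?c y) (cl \<A> \<B> \<phi> X ?c x ())"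
      using x y by (intro Comp_mono_left up_below_up_cl \<mu> presheaf_in_hom[OF cc]
          ty_in_Ob[OF qdistributor_dom[OF \<phi>]])
    also have "\<dots> \<preceq>\<langle>ty \<A> x,ty \<B> y\<rangle> \<phi> x y"
      using x y by (intro Comp_up_cl_below[OF \<phi> c])
    finally show ?thesis .
  qed
  then show ?thesis
    using x presheaf_in_hom[OF cc] by (simp add: below_cl_iff[OF \<phi> \<mu>])
qed

text \<open>
  Enriched antitonicity of \<open>\<phi>\<^sub>\<up>\<close>: the left-hand side composed with \<open>\<mu> x\<close> passes through
  \<open>\<phi>\<^sub>\<up> \<nu> y \<circ> \<nu> x\<close>, which lies below \<open>\<phi> x y\<close>.
\<close>

lemma up_antitone:
  assumes \<mu>: "(X, \<mu>) \<in> obs (presheaves Q \<A>)" and \<nu>: "(Y, \<nu>) \<in> obs (presheaves Q \<A>)"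
    and y: "y \<in> obs \<B>"
  shows "Comp Q X Y (ty \<B> y) (up \<A> \<B> \<phi> Y \<nu> y) (arr (presheaves Q \<A>) (X, \<mu>) (Y, \<nu>))
    \<preceq>\<langle>X,ty \<B> y\<rangle> up \<A> \<B> \<phi> X \<mu> y"
proof -
  let ?h = "arr (presheaves Q \<A>) (X, \<mu>) (Y, \<nu>)"
  have XY: "X \<in> Ob Q" "Y \<in> Ob Q" using \<mu> \<nu> by (simp_all add: presheaf_iff)
  note typing = XY qdistributor_dom[OF \<phi>, THEN ty_in_Ob] qdistributor_cod[OF \<phi>, THEN ty_in_Ob]
    presheaf_arr_in_hom[OF \<mu> \<nu>] presheaf_in_hom[OF \<mu>] presheaf_in_hom[OF \<nu>]
    up_in_hom[OF \<phi> \<nu>] Comp_closed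
  have "Comp Q (ty \<A> x) X (ty \<B> y) (Comp Q X Y (ty \<B> y) (up \<A> \<B> \<phi> Y \<nu> y) ?h) (\<mu> x ())
      \<preceq>\<langle>ty \<A> x,ty \<B> y\<rangle> \<phi> x y" if x: "x \<in> obs \<A>" for x
  proof -
    have "Comp Q (ty \<A> x) X (ty \<B> y) (Comp Q X Y (ty \<B> y) (up \<A> \<B> \<phi> Y \<nu> y) ?h) (\<mu> x ())
      = Comp Q (ty \<A> x) Y (ty \<B> y) (up \<A> \<B> \<phi> Y \<nu> y) (Comp Q (ty \<A> x) X Y ?h (\<mu> x ()))"
      using x y by (simp add: Comp_assoc typing)
    also have "\<dots> \<preceq>\<langle>ty \<A> x,ty \<B> y\<rangle> Comp Q (ty \<A> x) Y (ty \<B> y) (up \<A> \<B> \<phi> Y \<nu> y) (\<nu> x ())"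
      using x y by (intro Comp_mono_right Comp_presheaf_arr_below \<mu> \<nu> typing)
    also have "\<dots> \<preceq>\<langle>ty \<A> x,ty \<B> y\<rangle> \<phi> x y"
      using x y by (intro Comp_up_below[OF \<phi> \<nu>])
    finally show ?thesis .
  qed
  then show ?thesis using y by (simp add: below_up_iff[OF \<phi> \<mu>] typing)
qed

text \<open>
  An arrow \<open>h\<close> from \<open>\<mu>\<close> to \<open>\<nu>\<close> is compatible with closures: by \<open>up_antitone\<close>,
  \<open>\<phi>\<^sub>\<up> \<nu> y \<circ> h \<circ> c x \<le> \<phi>\<^sub>\<up> \<mu> y \<circ> c x \<le> \<phi> x y\<close> for the closure \<open>c\<close> of \<open>\<mu>\<close>.
\<close>

lemma presheaf_arr_below_cl:
  assumes \<mu>: "(X, \<mu>) \<in> obs (presheaves Q \<A>)" and \<nu>: "(Y, \<nu>) \<in> obs (presheaves Q \<A>)"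
  shows "arr (presheaves Q \<A>) (X, \<mu>) (Y, \<nu>)
    \<preceq>\<langle>X,Y\<rangle> arr (presheaves Q \<A>) (X, cl \<A> \<B> \<phi> X \<mu>) (Y, cl \<A> \<B> \<phi> Y \<nu>)"
proof -
  let ?h = "arr (presheaves Q \<A>) (X, \<mu>) (Y, \<nu>)"
  let ?c = "cl \<A> \<B> \<phi> X \<mu>"
  have XY: "X \<in> Ob Q" "Y \<in> Ob Q" using \<mu> \<nu> by (simp_all add: presheaf_iff)
  note c = cl_presheaf[OF \<phi> \<mu>] and d = cl_presheaf[OF \<phi> \<nu>]
  note typing = XY qdistributor_dom[OF \<phi>, THEN ty_in_Ob] qdistributor_cod[OF \<phi>, THEN ty_in_Ob]
    presheaf_arr_in_hom[OF \<mu> \<nu>] presheaf_in_hom[OF c] up_in_hom[OF \<phi> \<nu>] up_in_hom[OF \<phi> \<mu>]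
    Comp_closed
  have "Comp Q (ty \<A> x) Y (ty \<B> y) (up \<A> \<B> \<phi> Y \<nu> y) (Comp Q (ty \<A> x) X Y ?h (?c x ()))
      \<preceq>\<langle>ty \<A> x,ty \<B> y\<rangle> \<phi> x y" if o: "x \<in> obs \<A>" "y \<in> obs \<B>" for x y
  proof -
    have "Comp Q (ty \<A> x) Y (ty \<B> y) (up \<A> \<B> \<phi> Y \<nu> y) (Comp Q (ty \<A> x) X Y ?h (?c x ()))
      = Comp Q (ty \<A> x) X (ty \<B> y) (Comp Q X Y (ty \<B> y) (up \<A> \<B> \<phi> Y \<nu> y) ?h) (?c x ())"
      using o by (simp add: Comp_assoc typing)
    also have "\<dots> \<preceq>\<langle>ty \<A> x,ty \<B> y\<rangle> Comp Q (ty \<A> x) X (ty \<B> y) (up \<A> \<B> \<phi> X \<mu> y) (?c x ())"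
      using o by (intro Comp_mono_left up_antitone \<mu> \<nu> typing)
    also have "\<dots> \<preceq>\<langle>ty \<A> x,ty \<B> y\<rangle> \<phi> x y"
      using o by (intro Comp_up_cl_below[OF \<phi> \<mu>])
    finally show ?thesis .
  qed
  then show ?thesis
    by (simp add: below_presheaf_arr_iff[OF c d] below_cl_iff[OF \<phi> \<nu>] typing)
qed

lemma isbell_closure_space: "qclosure_space Q \<A> (isbell_closure \<A> \<B> \<phi>)"
proof -
  let ?P = "presheaves Q \<A>" and ?C = "isbell_closure \<A> \<B> \<phi>"
  note eq = isbell_closure_eq
  have P: "qcategory Q ?P" by (rule qcategory_presheaves[OF qdistributor_dom[OF \<phi>]])
  have "qfunctor Q ?P ?P ?C"
    unfolding qfunctor_def
    using P cl_presheaf[OF \<phi>] presheaf_arr_below_cl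
    by (auto simp: eq below_def simp del: comp_apply)
  moreover have "qfunctor_le Q ?P ?P id ?C"
    using below_cl[OF \<phi>] cl_presheaf[OF \<phi>]
    by (auto simp: qfunctor_le_def eq qle_presheaves_iff simp del: comp_apply)
  moreover have "qiso Q ?P ((?C \<circ> ?C) (X, \<mu>)) (?C (X, \<mu>))" if \<mu>: "(X, \<mu>) \<in> obs ?P" for X \<mu>
  proof -
    have "(?C \<circ> ?C) (X, \<mu>) = (X, cl \<A> \<B> \<phi> X (cl \<A> \<B> \<phi> X \<mu>))"
      by (subst comp_apply) (simp only: eq)
    then show ?thesis
      using cl_presheaf[OF \<phi> \<mu>] cl_presheaf[OF \<phi> cl_presheaf[OF \<phi> \<mu>]]
        cl_cl_below[OF \<mu>] below_cl[OF \<phi> cl_presheaf[OF \<phi> \<mu>]]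
      by (simp add: qiso_def eq qle_presheaves_iff del: comp_apply)
  qed
  ultimately show ?thesis
    using qdistributor_dom[OF \<phi>]
    by (auto simp: qclosure_space_def qclosure_operator_def qfunctor_iso_def simp del: comp_apply)
qed

end

section \<open>Direct images and continuity\<close>

abbreviation pushforward where
  "pushforward \<A> \<B> F X \<mu> \<equiv> dcomp Q \<B> \<A> (star Q X) \<mu> (cograph \<A> \<B> F)"

lemma direct_image_eq: "direct_image Q \<A> \<B> F (X, \<mu>) = (X, pushforward \<A> \<B> F X \<mu>)"
  by (simp add: direct_image_def)

context
  fixes \<A> :: "('o, 'm, 'a) qcat_data" and \<B> :: "('o, 'm, 'b) qcat_data" and F X \<mu>
  assumes F: "qfunctor Q \<A> \<B> F" and \<mu>: "(X, \<mu>) \<in> obs (presheaves Q \<A>)"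
begin

lemma pushforward_presheaf: "(X, pushforward \<A> \<B> F X \<mu>) \<in> obs (presheaves Q \<B>)"
  using dcomp_qdistributor[OF cograph_qdistributor[OF F], of "star Q X" \<mu>] \<mu>
  by (simp add: presheaf_iff)

lemma pushforward_below_iff:
  assumes "y \<in> obs \<B>" "h \<in> hom (ty \<B> y) X"
  shows "pushforward \<A> \<B> F X \<mu> y () \<preceq>\<langle>ty \<B> y,X\<rangle> h \<longleftrightarrow>
    (\<forall>x\<in>obs \<A>. Comp Q (ty \<B> y) (ty \<A> x) X (\<mu> x ()) (arr \<B> y (F x)) \<preceq>\<langle>ty \<B> y,X\<rangle> h)"
  using dcomp_below_iff[OF cograph_qdistributor[OF F], of "star Q X" \<mu> y "()" h] \<mu> assms
  by (simp add: presheaf_iff cograph_def)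

text \<open>
  The unit of the adjunction between direct and inverse image, as the inverse image of a presheaf
  along \<open>F\<close> is precomposition with \<open>F\<close>.
\<close>

lemma below_pushforward:
  assumes x: "x \<in> obs \<A>"
  shows "\<mu> x () \<preceq>\<langle>ty \<A> x,X\<rangle> pushforward \<A> \<B> F X \<mu> (F x) ()"
proof -
  have t: "ty \<A> x \<in> Ob Q" "X \<in> Ob Q" "\<mu> x () \<in> hom (ty \<A> x) X"
    using x \<mu> presheaf_in_hom[OF \<mu>] ty_in_Ob[OF qfunctor_dom[OF F]] by (auto simp: presheaf_iff)
  have "\<mu> x () = Comp Q (ty \<A> x) (ty \<A> x) X (\<mu> x ()) (Idn Q (ty \<A> x))"
    using t by (simp add: Comp_Idn_right)
  also have "\<dots> \<preceq>\<langle>ty \<A> x,X\<rangle> Comp Q (ty \<A> x) (ty \<A> x) X (\<mu> x ()) (arr \<B> (F x) (F x))"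
    using x t by (intro Comp_mono_right Idn_below_arr_image[OF F])
  also have "\<dots> \<preceq>\<langle>ty \<A> x,X\<rangle> pushforward \<A> \<B> F X \<mu> (F x) ()"
    using Comp_below_dcomp[OF cograph_qdistributor[OF F], of "star Q X" \<mu> "F x" x "()"] \<mu> x
    by (simp add: presheaf_iff cograph_def qfunctor_obs[OF F] qfunctor_ty[OF F])
  finally show ?thesis .
qed

end

context
  fixes \<A> :: "('o, 'm, 'a) qcat_data" and \<B> :: "('o, 'm, 'b) qcat_data"
    and \<A>' :: "('o, 'm, 'c) qcat_data" and \<B>' :: "('o, 'm, 'd) qcat_data" and \<phi> \<psi> F G X \<mu>
  assumes info: "infomorphism Q \<A> \<B> \<phi> \<A>' \<B>' \<psi> F G"
    and \<mu>: "(X, \<mu>) \<in> obs (presheaves Q \<A>)"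
begin

text \<open>
  This is where the infomorphism is used in the direction from \<open>\<psi>\<close> to \<open>\<phi>\<close>. If \<open>v \<circ> \<mu>' x' \<le> \<psi> x' y\<close>
  for the direct image \<open>\<mu>'\<close> of \<open>\<mu>\<close> and all \<open>x'\<close>, then the instances \<open>x' = F x\<close> show that
  \<open>v \<circ> \<mu> x \<le> \<psi> (F x) y = \<phi> x (G y)\<close>.
\<close>

lemma up_pushforward_below:
  assumes y: "y \<in> obs \<B>'"
  shows "up \<A>' \<B>' \<psi> X (pushforward \<A> \<A>' F X \<mu>) y \<preceq>\<langle>X,ty \<B>' y\<rangle> up \<A> \<B> \<phi> X \<mu> (G y)"
proof -
  have \<phi>: "qdistributor Q \<A> \<B> \<phi>" and \<psi>: "qdistributor Q \<A>' \<B>' \<psi>"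
    and F: "qfunctor Q \<A> \<A>' F" and G: "qfunctor Q \<B>' \<B> G"
    using info by (auto simp: infomorphism_def)
  let ?v = "up \<A>' \<B>' \<psi> X (pushforward \<A> \<A>' F X \<mu>) y"
  have Gy: "G y \<in> obs \<B>" "ty \<B> (G y) = ty \<B>' y" using y qfunctorD[OF G] by auto
  note im = pushforward_presheaf[OF F \<mu>]
  have v: "?v \<in> hom X (ty \<B>' y)" by (rule up_in_hom[OF \<psi> im y])
  have "Comp Q (ty \<A> x) X (ty \<B>' y) ?v (\<mu> x ()) \<preceq>\<langle>ty \<A> x,ty \<B>' y\<rangle> \<phi> x (G y)"
    if x: "x \<in> obs \<A>" for x
  proof -
    have "Comp Q (ty \<A> x) X (ty \<B>' y) ?v (\<mu> x ())
      \<preceq>\<langle>ty \<A> x,ty \<B>' y\<rangle> Comp Q (ty \<A> x) X (ty \<B>' y) ?v (pushforward \<A> \<A>' F X \<mu> (F x) ())"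
      using x y v by (intro Comp_mono_right below_pushforward[OF F \<mu>] ty_in_Ob[OF qfunctor_dom[OF G]])
    also have "\<dots> \<preceq>\<langle>ty \<A> x,ty \<B>' y\<rangle> \<psi> (F x) y"
      using Comp_up_below[OF \<psi> im qfunctor_obs[OF F x] y] x by (simp add: qfunctor_ty[OF F])
    also have "\<psi> (F x) y = \<phi> x (G y)"
      using infomorphism_components[OF info x y] by simp
    finally show ?thesis .
  qed
  then show ?thesis
    using below_up_iff[OF \<phi> \<mu> Gy(1), of ?v] Gy v by simp
qed

text \<open>
  Let \<open>c\<close> be the closure of \<open>\<mu>\<close>, and \<open>v\<close> the image under \<open>\<psi>\<^sub>\<up>\<close> of the direct image of \<open>\<mu>\<close>. By the
  universal properties of join and residual, it suffices to bound the composite of \<open>v y\<close> with one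
  member of the join by \<open>\<psi> x' y\<close>. By \<open>up_pushforward_below\<close>, \<open>v y\<close> can be replaced with an arrow
  whose composite with \<open>c x\<close> is bounded by \<open>\<phi>\<close>; the infomorphism then leads back to \<open>\<psi>\<close>.
\<close>

lemma pushforward_cl_below_cl_pushforward:
  assumes x': "x' \<in> obs \<A>'"
  shows "pushforward \<A> \<A>' F X (cl \<A> \<B> \<phi> X \<mu>) x' ()
    \<preceq>\<langle>ty \<A>' x',X\<rangle> cl \<A>' \<B>' \<psi> X (pushforward \<A> \<A>' F X \<mu>) x' ()"
proof -
  have \<phi>: "qdistributor Q \<A> \<B> \<phi>" and \<psi>: "qdistributor Q \<A>' \<B>' \<psi>"
    and F: "qfunctor Q \<A> \<A>' F" and G: "qfunctor Q \<B>' \<B> G"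
    using info by (auto simp: infomorphism_def)
  let ?v = "up \<A>' \<B>' \<psi> X (pushforward \<A> \<A>' F X \<mu>)" and ?c = "cl \<A> \<B> \<phi> X \<mu>"
  note im = pushforward_presheaf[OF F \<mu>] and c = cl_presheaf[OF \<phi> \<mu>]
  have X: "X \<in> Ob Q" using \<mu> by (simp add: presheaf_iff)
  note typing = X qfunctor_dom[OF F, THEN ty_in_Ob] qfunctor_cod[OF F, THEN ty_in_Ob]
    qfunctor_dom[OF G, THEN ty_in_Ob] up_in_hom[OF \<psi> im] presheaf_in_hom[OF c]
    arr_image_in_hom[OF F] Comp_closed
  have "Comp Q (ty \<A>' x') X (ty \<B>' y) (?v y) (Comp Q (ty \<A>' x') (ty \<A> x) X (?c x ()) (arr \<A>' x' (F x)))
      \<preceq>\<langle>ty \<A>' x',ty \<B>' y\<rangle> \<psi> x' y" if o: "x \<in> obs \<A>" "y \<in> obs \<B>'" for x y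
  proof -
    have Gy: "G y \<in> obs \<B>" "ty \<B> (G y) = ty \<B>' y" using o qfunctorD[OF G] by auto
    have "Comp Q (ty \<A> x) X (ty \<B>' y) (?v y) (?c x ())
      \<preceq>\<langle>ty \<A> x,ty \<B>' y\<rangle> Comp Q (ty \<A> x) X (ty \<B>' y) (up \<A> \<B> \<phi> X \<mu> (G y)) (?c x ())"
      using o by (intro Comp_mono_left up_pushforward_below typing)
    also have "\<dots> \<preceq>\<langle>ty \<A> x,ty \<B>' y\<rangle> \<phi> x (G y)"
      using Comp_up_cl_below[OF \<phi> \<mu> o(1) Gy(1)] Gy by simp
    also have "\<phi> x (G y) = \<psi> (F x) y"
      by (rule infomorphism_components[OF info o])
    finally have *: "Comp Q (ty \<A> x) X (ty \<B>' y) (?v y) (?c x ()) \<preceq>\<langle>ty \<A> x,ty \<B>' y\<rangle> \<psi> (F x) y" .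
    have "Comp Q (ty \<A>' x') X (ty \<B>' y) (?v y)
        (Comp Q (ty \<A>' x') (ty \<A> x) X (?c x ()) (arr \<A>' x' (F x)))
      = Comp Q (ty \<A>' x') (ty \<A> x) (ty \<B>' y)
        (Comp Q (ty \<A> x) X (ty \<B>' y) (?v y) (?c x ())) (arr \<A>' x' (F x))"
      using o x' by (simp add: Comp_assoc typing)
    also have "\<dots> \<preceq>\<langle>ty \<A>' x',ty \<B>' y\<rangle>
        Comp Q (ty \<A>' x') (ty \<A> x) (ty \<B>' y) (\<psi> (F x) y) (arr \<A>' x' (F x))"
      using o x' by (intro Comp_mono_left[OF *] typing)
    also have "\<dots> \<preceq>\<langle>ty \<A>' x',ty \<B>' y\<rangle> \<psi> x' y"
      using qdistributor_dom_action[OF \<psi> x' qfunctor_obs[OF F o(1)] o(2)] o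
      by (simp add: qfunctor_ty[OF F])
    finally show ?thesis .
  qed
  then have "Comp Q (ty \<A>' x') (ty \<A> x) X (?c x ()) (arr \<A>' x' (F x))
      \<preceq>\<langle>ty \<A>' x',X\<rangle> cl \<A>' \<B>' \<psi> X (pushforward \<A> \<A>' F X \<mu>) x' ()" if "x \<in> obs \<A>" for x
    using that x' by (simp add: below_cl_iff[OF \<psi> im] typing)
  then show ?thesis
    using pushforward_below_iff[OF F c x'] presheaf_in_hom[OF cl_presheaf[OF \<psi> im] x'] by simp
qed

end

end

theorem proposition4p5:
  fixes Q :: "('o, 'm) quantaloid_data"
    and \<A> :: "('o, 'm, 'a) qcat_data" and \<B> :: "('o, 'm, 'b) qcat_data"
    and \<A>' :: "('o, 'm, 'c) qcat_data" and \<B>' :: "('o, 'm, 'd) qcat_data"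
  assumes "quantaloid Q"
    and "qdistributor Q \<A> \<B> \<phi>"
    and "qdistributor Q \<A>' \<B>' \<psi>"
    and "infomorphism Q \<A> \<B> \<phi> \<A>' \<B>' \<psi> F G"
  shows "continuous_qfunctor Q
           \<A> (isbell_down Q \<A> \<B> \<phi> \<circ> isbell_up Q \<A> \<B> \<phi>)
           \<A>' (isbell_down Q \<A>' \<B>' \<psi> \<circ> isbell_up Q \<A>' \<B>' \<psi>) F"
proof -
  interpret quantaloid Q by fact
  have F: "qfunctor Q \<A> \<A>' F" using assms(4) by (simp add: infomorphism_def)
  have "qle Q (presheaves Q \<A>')
      (direct_image Q \<A> \<A>' F (isbell_closure \<A> \<B> \<phi> (X, \<mu>)))
      (isbell_closure \<A>' \<B>' \<psi> (direct_image Q \<A> \<A>' F (X, \<mu>)))"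
    if \<mu>: "(X, \<mu>) \<in> obs (presheaves Q \<A>)" for X \<mu>
    unfolding isbell_closure_eq direct_image_eq
    using pushforward_cl_below_cl_pushforward[OF assms(4) \<mu>]
      pushforward_presheaf[OF F cl_presheaf[OF assms(2) \<mu>]]
      cl_presheaf[OF assms(3) pushforward_presheaf[OF F \<mu>]]
    by (simp add: qle_presheaves_iff)
  then show ?thesis
    using isbell_closure_space[OF assms(2)] isbell_closure_space[OF assms(3)] F
    by (auto simp: continuous_qfunctor_def qfunctor_le_def)
qed

end
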